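(* Let $T$ be a non-empty set and $c\colon T^3\to T$ a map. (i) $(T,c)$ is an order separable algebraic continuum tree if and only if there exists a metric $r$ on $T$ such that $(T,r)$ is a compact $\mathbb{R}$-tree with $c=c_{(T,r)}$. (ii) $(T,c)$ is an order separable algebraic tree if and only if there is an order separable algebraic continuum tree $(\overline{T},\overline{c})$ such that $(T,c)$ is a subtree of $(\overline{T},\overline{c})$ (i.e. $T\subseteq\overline{T}$, $\overline{c}(T^3)\subseteq T$, and $c$ is the restriction of $\overline{c}$ to $T^3$). In particular, every order separable algebraic tree $(T,c)$ is induced by a totally bounded metric tree, i.e. there is a metric $r$ on $T$ such that $(T,r)$ is a totally bounded metric tree with $c=c_{(T,r)}$.
   Context: An algebraic tree $(T,c)$ is a set $T\neq\emptyset$ with a map $c\colon T^3\to T$ (the branch point map) such that for all points of $T$: $c$ is symmetric; $c(x,y,y)=y$; $c(x,y,c(x,y,z))=c(x,y,z)$; and $c(x_1,x_2,x_3)\in\{c(x_1,x_2,x_4),c(x_1,x_3,x_4),c(x_2,x_3,x_4)\}$. Intervals: $[x,y]:=\{z\in T: c(x,y,z)=z\}$ and $[x,y):=[x,y]\setminus\{y\}$. An edge is a set $\{x,y\}$ with $x\neq y$ and $[x,y]=\{x,y\}$. $(T,c)$ is order separable if there is a countable $D\subseteq T$ with $D\cap[x,y)\neq\emptyset$ for all $x\ne y$ in $T$. For $\rho\in T$ let $\le_\rho$ be the partial order $x\le_\rho y:\iff x\in[\rho,y]$. $(T,c)$ is order complete if for every $\rho\in T$ every non-empty totally ordered subset of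 $(T,\le_\rho)$ has a supremum in $(T,\le_\rho)$. An algebraic continuum tree is an order complete algebraic tree without edges. A metric space $(T,r)$ satisfies the 4-point condition if $r(x_1,x_2)+r(x_3,x_4)\le\max\{r(x_1,x_3)+r(x_2,x_4),\,r(x_1,x_4)+r(x_2,x_3)\}$ for all $x_1,\dots,x_4$. An $\mathbb{R}$-tree is a connected metric space satisfying the 4-point condition. A metric tree is a metric space satisfying the 4-point condition such that for all $x_1,x_2,x_3\in T$ there is a (necessarily unique) point $c_{(T,r)}(x_1,x_2,x_3)\in T$ with $r(x_i,c_{(T,r)}(x_1,x_2,x_3))+r(c_{(T,r)}(x_1,x_2,x_3),x_j)=r(x_i,x_j)$ for all $i\ne j$ in $\{1,2,3\}$. Every $\mathbb{R}$-tree is a metric tree. *)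

theory Defs
  imports "HOL-Analysis.Analysis"
begin

text \<open>Maps \<open>T\<^sup>3 \<rightarrow> T\<close> are represented by total curried functions on the ambient type; only
  their values on \<open>T\<close> are ever used. Hence equality of two such maps is always stated pointwise
  on \<open>T\<close>.\<close>

locale algebraic_tree =
  fixes T :: "'a set" and c :: "'a \<Rightarrow> 'a \<Rightarrow> 'a \<Rightarrow> 'a"
  assumes nonempty: "T \<noteq> {}"
    and closed: "\<lbrakk>x \<in> T; y \<in> T; z \<in> T\<rbrakk> \<Longrightarrow> c x y z \<in> T"
    and sym12: "\<lbrakk>x \<in> T; y \<in> T; z \<in> T\<rbrakk> \<Longrightarrow> c x y z = c y x z"
    and sym23: "\<lbrakk>x \<in> T; y \<in> T; z \<in> T\<rbrakk> \<Longrightarrow> c x y z = c x z y"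
    and two_point: "\<lbrakk>x \<in> T; y \<in> T\<rbrakk> \<Longrightarrow> c x y y = y"
    and three_point: "\<lbrakk>x \<in> T; y \<in> T; z \<in> T\<rbrakk> \<Longrightarrow> c x y (c x y z) = c x y z"
    and four_point: "\<lbrakk>x\<^sub>1 \<in> T; x\<^sub>2 \<in> T; x\<^sub>3 \<in> T; x\<^sub>4 \<in> T\<rbrakk> \<Longrightarrow>
      c x\<^sub>1 x\<^sub>2 x\<^sub>3 \<in> {c x\<^sub>1 x\<^sub>2 x\<^sub>4, c x\<^sub>1 x\<^sub>3 x\<^sub>4, c x\<^sub>2 x\<^sub>3 x\<^sub>4}"

definition tree_interval :: "'a set \<Rightarrow> ('a \<Rightarrow> 'a \<Rightarrow> 'a \<Rightarrow> 'a) \<Rightarrow> 'a \<Rightarrow> 'a \<Rightarrow> 'a set" where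
  "tree_interval T c x y = {z \<in> T. c x y z = z}"

definition tree_edges :: "'a set \<Rightarrow> ('a \<Rightarrow> 'a \<Rightarrow> 'a \<Rightarrow> 'a) \<Rightarrow> 'a set set" where
  "tree_edges T c = {{x, y} | x y. x \<in> T \<and> y \<in> T \<and> x \<noteq> y \<and> tree_interval T c x y = {x, y}}"

definition order_separable :: "'a set \<Rightarrow> ('a \<Rightarrow> 'a \<Rightarrow> 'a \<Rightarrow> 'a) \<Rightarrow> bool" where
  "order_separable T c \<longleftrightarrow>
    (\<exists>D. countable D \<and> D \<subseteq> T \<and>
      (\<forall>x\<in>T. \<forall>y\<in>T. x \<noteq> y \<longrightarrow> D \<inter> (tree_interval T c x y - {y}) \<noteq> {}))"

definition tree_le :: "'a set \<Rightarrow> ('a \<Rightarrow> 'a \<Rightarrow> 'a \<Rightarrow> 'a) \<Rightarrow> 'a \<Rightarrow> 'a \<Rightarrow> 'a \<Rightarrow> bool" where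
  "tree_le T c \<rho> x y \<longleftrightarrow> x \<in> tree_interval T c \<rho> y"

definition is_supremum :: "'a set \<Rightarrow> ('a \<Rightarrow> 'a \<Rightarrow> bool) \<Rightarrow> 'a set \<Rightarrow> 'a \<Rightarrow> bool" where
  "is_supremum T le C s \<longleftrightarrow>
    s \<in> T \<and> (\<forall>x\<in>C. le x s) \<and> (\<forall>u\<in>T. (\<forall>x\<in>C. le x u) \<longrightarrow> le s u)"

definition order_complete :: "'a set \<Rightarrow> ('a \<Rightarrow> 'a \<Rightarrow> 'a \<Rightarrow> 'a) \<Rightarrow> bool" where
  "order_complete T c \<longleftrightarrow>
    (\<forall>\<rho>\<in>T. \<forall>C. C \<subseteq> T \<and> C \<noteq> {} \<and> Complete_Partial_Order.chain (tree_le T c \<rho>) C \<longrightarrow>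
      (\<exists>s. is_supremum T (tree_le T c \<rho>) C s))"

locale algebraic_continuum_tree = algebraic_tree +
  assumes complete: "order_complete T c"
    and no_edges: "tree_edges T c = {}"

definition subtree ::
    "'a set \<Rightarrow> ('a \<Rightarrow> 'a \<Rightarrow> 'a \<Rightarrow> 'a) \<Rightarrow> 'a set \<Rightarrow> ('a \<Rightarrow> 'a \<Rightarrow> 'a \<Rightarrow> 'a) \<Rightarrow> bool" where
  "subtree T c T' c' \<longleftrightarrow>
    T \<subseteq> T' \<and>
    (\<forall>x\<in>T. \<forall>y\<in>T. \<forall>z\<in>T. c' x y z \<in> T) \<and>
    (\<forall>x\<in>T. \<forall>y\<in>T. \<forall>z\<in>T. c x y z = c' x y z)"

text \<open>For \<open>f\<close> injective on \<open>T\<close>, this is the map on \<open>(f ` T)\<^sup>3\<close> corresponding to \<open>c\<close> under the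
  identification of \<open>T\<close> with its copy \<open>f ` T\<close>. It is needed because a tree \<open>T\<close> exhausting its
  ambient type has no room there for additional points. An order separable algebraic continuum
  tree has at most continuum many points, being a compact metric space, so an extension of
  \<open>T :: 'a set\<close> of this kind can always be realised in the type \<open>'a + real\<close>.\<close>

definition transport_map ::
    "('a \<Rightarrow> 'b) \<Rightarrow> 'a set \<Rightarrow> ('a \<Rightarrow> 'a \<Rightarrow> 'a \<Rightarrow> 'a) \<Rightarrow> 'b \<Rightarrow> 'b \<Rightarrow> 'b \<Rightarrow> 'b" where
  "transport_map f T c = (\<lambda>x y z. f (c (inv_into T f x) (inv_into T f y) (inv_into T f z)))"

locale four_point_metric_space = Metric_space +
  assumes four_point: "\<lbrakk>x\<^sub>1 \<in> M; x\<^sub>2 \<in> M; x\<^sub>3 \<in> M; x\<^sub>4 \<in> M\<rbrakk> \<Longrightarrow>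
    d x\<^sub>1 x\<^sub>2 + d x\<^sub>3 x\<^sub>4 \<le> max (d x\<^sub>1 x\<^sub>3 + d x\<^sub>2 x\<^sub>4) (d x\<^sub>1 x\<^sub>4 + d x\<^sub>2 x\<^sub>3)"

locale real_tree = four_point_metric_space +
  assumes connected: "connected_space mtopology"

definition is_metric_branch_point ::
    "'a set \<Rightarrow> ('a \<Rightarrow> 'a \<Rightarrow> real) \<Rightarrow> 'a \<Rightarrow> 'a \<Rightarrow> 'a \<Rightarrow> 'a \<Rightarrow> bool" where
  "is_metric_branch_point M d x\<^sub>1 x\<^sub>2 x\<^sub>3 m \<longleftrightarrow>
    m \<in> M \<and>
    d x\<^sub>1 m + d m x\<^sub>2 = d x\<^sub>1 x\<^sub>2 \<and>
    d x\<^sub>1 m + d m x\<^sub>3 = d x\<^sub>1 x\<^sub>3 \<and>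
    d x\<^sub>2 m + d m x\<^sub>3 = d x\<^sub>2 x\<^sub>3"

locale metric_tree = four_point_metric_space +
  assumes branch_point: "\<lbrakk>x\<^sub>1 \<in> M; x\<^sub>2 \<in> M; x\<^sub>3 \<in> M\<rbrakk> \<Longrightarrow>
    \<exists>m. is_metric_branch_point M d x\<^sub>1 x\<^sub>2 x\<^sub>3 m"

definition metric_branch_map ::
    "'a set \<Rightarrow> ('a \<Rightarrow> 'a \<Rightarrow> real) \<Rightarrow> 'a \<Rightarrow> 'a \<Rightarrow> 'a \<Rightarrow> 'a" where
  "metric_branch_map M d x\<^sub>1 x\<^sub>2 x\<^sub>3 = (THE m. is_metric_branch_point M d x\<^sub>1 x\<^sub>2 x\<^sub>3 m)"

definition induced_by_metric ::
    "'a set \<Rightarrow> ('a \<Rightarrow> 'a \<Rightarrow> 'a \<Rightarrow> 'a) \<Rightarrow> ('a \<Rightarrow> 'a \<Rightarrow> real) \<Rightarrow> bool" where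
  "induced_by_metric T c r \<longleftrightarrow>
    (\<forall>x\<in>T. \<forall>y\<in>T. \<forall>z\<in>T. c x y z = metric_branch_map T r x y z)"

end

theory Submission imports Defs begin

text \<open>
  Fix a root and let \<open>\<preceq>\<close> be the induced order, with meets \<open>c \<rho> x y\<close>. Order separability provides a
  sequence \<open>y\<^sub>k\<close> meeting every nontrivial upper segment, hence a strictly increasing height function
  \<open>h\<close> with values in \<open>[0,1]\<close>, such as \<open>\<Sum>k. 2\<^sup>-\<^sup>k\<^sup>-\<^sup>1 [y\<^sub>k \<preceq> x]\<close>. The coordinates \<open>h (x \<and> y\<^sub>k)\<close> embed the
  tree into the cube \<open>[0,1]\<^sup>\<nat>\<close> in such a way that branch points become coordinatewise medians. The
  sequences satisfying the same ultrametric inequalities with respect to the \<open>h (y\<^sub>k \<and> y\<^sub>l)\<close> form a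
  closed, hence compact, subset of the cube, which is connected because truncation \<open>min t G\<close> is a path
  from \<open>0\<close> to \<open>G\<close>, and on which the weighted sum of the coordinate distances is a real tree metric.
  This is the continuum tree extending the given one, and total boundedness is inherited.

  For an algebraic continuum tree one can choose \<open>h\<close> with the intermediate value property, namely as
  a weighted sum of jump-free functions built from dyadic chains between points of the sequence; then
  order completeness makes the embedding surjective.

  Conversely, a compact real tree is geodesic, the branch point axioms follow from the 4-point
  condition, and suprema of chains come from the finite intersection property. A separable metric
  tree, in particular a subtree of a compact one, is order separable.
\<close>

section \<open>From metrics to algebraic trees\<close>

text \<open>Carries the branch map as data with its defining property; the definite description in
  \<open>metric_branch_map\<close> is resolved in \<open>metric_tree_map_iff\<close>.\<close>

locale metric_tree_map = four_point_metric_space M d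
  for M :: "'a set" and d :: "'a \<Rightarrow> 'a \<Rightarrow> real" +
  fixes c :: "'a \<Rightarrow> 'a \<Rightarrow> 'a \<Rightarrow> 'a"
  assumes carrier_nonempty: "M \<noteq> {}"
    and is_branch: "\<lbrakk>x \<in> M; y \<in> M; z \<in> M\<rbrakk> \<Longrightarrow> is_metric_branch_point M d x y z (c x y z)"

lemma is_metric_branch_pointD:
  assumes "is_metric_branch_point M d x y z m"
  shows "m \<in> M" "d x m + d m y = d x y" "d x m + d m z = d x z" "d y m + d m z = d y z"
  using assms by (auto simp: is_metric_branch_point_def)

section \<open>Segments in four-point spaces\<close>

context four_point_metric_space
begin

text \<open>Applied to the pairs \<open>x\<close>, \<open>y\<close> and \<open>z\<close>,
  \<open>w\<close>, the four-point condition has both right-hand sums equal to \<open>d x y\<close>,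
  so \<open>d z w \<le> 0\<close>.\<close>

lemma between_unique:
  assumes "x \<in> M" "y \<in> M" "z \<in> M" "w \<in> M"
    and "d x z + d z y = d x y" "d x w + d w y = d x y" "d x z = d x w"
  shows "z = w"
proof -
  have "d x y + d z w \<le> max (d x z + d y w) (d x w + d y z)"
    using four_point assms by blast
  then have "d z w \<le> 0"
    using assms commute[of y w] commute[of y z] by auto
  then show ?thesis
    using assms nonneg[of z w] zero by fastforce
qed

text \<open>The four-point condition bounds \<open>d z w\<close> from above, the triangle inequality
  from below. So a metric segment is isometric to a subset of a real interval.\<close>

lemma between_dist:
  assumes "a \<in> M" "b \<in> M" "z \<in> M" "w \<in> M"
    and "d a z + d z b = d a b" "d a w + d w b = d a b" "d a z \<le> d a w"
  shows "d z w = d a w - d a z"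
proof -
  have "d a b + d z w \<le> max (d a z + d b w) (d a w + d b z)"
    using four_point assms by blast
  then show ?thesis
    using assms commute[of b w] commute[of b z] triangle[of a z w] by auto
qed

text \<open>The sum \<open>d a y + d x b\<close> exceeds \<open>d a x + d y b\<close> by
  \<open>2 * d x y > 0\<close>, so the other sum must be the maximum in the four-point condition.
  With \<open>x = y\<close> the two segments could turn back on each other.\<close>

lemma between_concat:
  assumes "a \<in> M" "b \<in> M" "x \<in> M" "y \<in> M" "x \<noteq> y"
    and "d a x + d x y = d a y" "d x y + d y b = d x b"
  shows "d a b = d a x + d x y + d y b"
proof -
  have "d a y + d x b \<le> max (d a x + d y b) (d a b + d y x)"
    using four_point[of a y x b] assms by auto
  moreover have "d x y > 0" using assms by simp
  ultimately show ?thesis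
    using assms commute[of x y] triangle[of a x b] by linarith
qed

text \<open>The equations force \<open>d x m\<close> to be the Gromov product
  \<open>(d x y + d x z - d y z) / 2\<close>, and its distance from one end determines a point of a
  segment.\<close>

lemma metric_branch_point_unique:
  assumes "x \<in> M" "y \<in> M" "z \<in> M"
    and m: "is_metric_branch_point M d x y z m" and n: "is_metric_branch_point M d x y z n"
  shows "m = n"
proof (rule between_unique)
  show "d x m = d x n"
    using is_metric_branch_pointD[OF m] is_metric_branch_pointD[OF n] assms
      commute[of m] commute[of n] by (smt (verit))
qed (use assms is_metric_branch_pointD[OF m] is_metric_branch_pointD[OF n] in auto)

lemma metric_branch_map_eq:
  assumes "x \<in> M" "y \<in> M" "z \<in> M" "is_metric_branch_point M d x y z m"
  shows "metric_branch_map M d x y z = m"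
  unfolding metric_branch_map_def
  using assms metric_branch_point_unique by (intro the_equality) auto

end

lemma metric_tree_map_iff:
  assumes "M \<noteq> {}"
  shows "metric_tree_map M d c \<longleftrightarrow> metric_tree M d \<and> induced_by_metric M c d"
proof
  assume "metric_tree_map M d c"
  then interpret metric_tree_map M d c .
  show "metric_tree M d \<and> induced_by_metric M c d"
    unfolding induced_by_metric_def
    using is_branch metric_branch_map_eq[OF _ _ _ is_branch]
    by (auto intro!: metric_tree.intro metric_tree_axioms.intro four_point_metric_space_axioms)
next
  assume R: "metric_tree M d \<and> induced_by_metric M c d"
  then interpret metric_tree M d by simp
  show "metric_tree_map M d c"
  proof
    fix x y z assume xyz: "x \<in> M" "y \<in> M" "z \<in> M"
    then obtain m where m: "is_metric_branch_point M d x y z m"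
      using branch_point by blast
    moreover have "c x y z = m"
      using R xyz m metric_branch_map_eq by (simp add: induced_by_metric_def)
    ultimately show "is_metric_branch_point M d x y z (c x y z)" by simp
  qed (use assms in auto)
qed

context metric_tree_map
begin

lemma branch_in [simp]: "\<lbrakk>x \<in> M; y \<in> M; z \<in> M\<rbrakk> \<Longrightarrow> c x y z \<in> M"
  by (rule is_metric_branch_pointD(1)[OF is_branch])

lemma branch_between:
  assumes "x \<in> M" "y \<in> M" "z \<in> M"
  shows "d x (c x y z) + d (c x y z) y = d x y"
    and "d x (c x y z) + d (c x y z) z = d x z"
    and "d y (c x y z) + d (c x y z) z = d y z"
  using is_metric_branch_pointD[OF is_branch[OF assms]] by simp_all

lemma branch_eqI:
  assumes "x \<in> M" "y \<in> M" "z \<in> M" "m \<in> M"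
    and "d x m + d m y = d x y" "d x m + d m z = d x z" "d y m + d m z = d y z"
  shows "c x y z = m"
  using assms metric_branch_point_unique is_branch by (simp add: is_metric_branch_point_def)

lemma branch_eq_iff:
  assumes "x \<in> M" "y \<in> M" "z \<in> M"
  shows "c x y z = z \<longleftrightarrow> d x z + d z y = d x y"
proof
  assume "c x y z = z"
  then show "d x z + d z y = d x y" using branch_between(1)[OF assms] by simp
next
  assume "d x z + d z y = d x y"
  then show "c x y z = z" using assms by (intro branch_eqI) auto
qed

lemma tree_interval_metric:
  "\<lbrakk>x \<in> M; y \<in> M\<rbrakk> \<Longrightarrow> tree_interval M c x y = {z \<in> M. d x z + d z y = d x y}"
  by (auto simp: tree_interval_def branch_eq_iff)

text \<open>The difference of the distances to \<open>x\<close> and \<open>y\<close> fixes the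
  projection to the segment from \<open>x\<close> to \<open>y\<close>; by hypothesis it is the same
  for \<open>z\<close> and \<open>w\<close>.\<close>

lemma branch_eq_of_equal_sums:
  assumes "x \<in> M" "y \<in> M" "z \<in> M" "w \<in> M" and "d x z + d y w = d x w + d y z"
  shows "c x y z = c x y w"
proof (rule between_unique[of x y])
  show "d x (c x y z) = d x (c x y w)"
    using branch_between[OF assms(1,2,3)] branch_between[OF assms(1,2,4)] assms(5)
      commute[of y "c x y z"] commute[of y "c x y w"] by linarith
qed (simp_all add: assms branch_between(1))

lemma branch_sym12: "\<lbrakk>x \<in> M; y \<in> M; z \<in> M\<rbrakk> \<Longrightarrow> c x y z = c y x z"
  using branch_between[of y x z] commute[of y x] commute[of "c y x z" x] commute[of "c y x z" y]
  by (intro branch_eqI) auto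

lemma branch_sym23: "\<lbrakk>x \<in> M; y \<in> M; z \<in> M\<rbrakk> \<Longrightarrow> c x y z = c x z y"
  using branch_between[of x z y] commute[of "c x z y" z] commute[of "c x z y" y] commute[of y z]
  by (intro branch_eqI) auto

text \<open>The two largest of the three pair sums agree; the pair forming the smallest sum determines
  which of the three branch points equals that of the first three points.\<close>

lemma branch_four_point:
  assumes "x \<in> M" "y \<in> M" "z \<in> M" "w \<in> M"
  shows "c x y z \<in> {c x y w, c x z w, c y z w}"
proof -
  have "d x y + d z w \<le> max (d x z + d y w) (d x w + d y z)"
    "d x z + d y w \<le> max (d x y + d z w) (d x w + d z y)"
    "d x w + d y z \<le> max (d x y + d w z) (d x z + d w y)"
    using four_point assms by blast+
  then consider "d x z + d y w = d x w + d y z" | "d x y + d z w = d x w + d y z"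
    | "d x y + d z w = d x z + d y w"
    using commute[of z y] commute[of w y] commute[of w z] by linarith
  then show ?thesis
  proof cases
    case 1
    then show ?thesis using branch_eq_of_equal_sums[OF assms] by simp
  next
    case 2
    then have "c x z y = c x z w"
      using assms commute[of z y] by (intro branch_eq_of_equal_sums) auto
    then show ?thesis using branch_sym23[OF assms(1-3)] by simp
  next
    case 3
    then have "c y z x = c y z w"
      using assms commute[of z x] commute[of y x] by (intro branch_eq_of_equal_sums) auto
    moreover have "c x y z = c y z x"
      using branch_sym12[of x y z] branch_sym23[of y x z] assms by simp
    ultimately show ?thesis by simp
  qed
qed

lemma algebraic_tree: "algebraic_tree M c"
proof
  show "M \<noteq> {}" by (rule carrier_nonempty)
  fix x y z assume xyz: "x \<in> M" "y \<in> M" "z \<in> M"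
  show "c x y z \<in> M" using xyz by simp
  show "c x y z = c y x z" using xyz by (rule branch_sym12)
  show "c x y z = c x z y" using xyz by (rule branch_sym23)
  show "c x y y = y" using xyz branch_eq_iff by simp
  show "c x y (c x y z) = c x y z"
    using xyz branch_eq_iff branch_between(1) by simp
next
  fix x y z w assume "x \<in> M" "y \<in> M" "z \<in> M" "w \<in> M"
  then show "c x y z \<in> {c x y w, c x z w, c y z w}" by (rule branch_four_point)
qed

text \<open>Total boundedness enters through a countable dense set \<open>Q\<close>. Points of
  \<open>Q\<close> need not lie in a given interval, so \<open>D\<close> consists of points chosen
  on segments between members of \<open>Q\<close> with rational cut-offs.\<close>

lemma order_separable:
  assumes "mtotally_bounded M"
  shows "order_separable M c"
proof -
  have "\<exists>K. finite K \<and> K \<subseteq> M \<and> M \<subseteq> (\<Union>x\<in>K. mball x (1 / Suc n))" for n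
    using assms unfolding mtotally_bounded_def by simp
  then obtain K where K: "\<And>n. finite (K n)" "\<And>n. K n \<subseteq> M" "\<And>n. M \<subseteq> (\<Union>x\<in>K n. mball x (1 / Suc n))"
    by metis
  define Q where "Q = (\<Union>n. K n)"
  have "countable Q" unfolding Q_def using K(1) by (auto intro: countable_finite)
  have QM: "Q \<subseteq> M" using K(2) Q_def by auto
  have dense: "\<exists>a\<in>Q. d a x < e" if "x \<in> M" "e > 0" for x e
  proof -
    obtain n where n: "1 / Suc n < e" using \<open>e > 0\<close> nat_approx_posE by blast
    obtain a where "a \<in> K n" "x \<in> mball a (1 / Suc n)" using K(3) \<open>x \<in> M\<close> by blast
    then show ?thesis using n Q_def by (intro bexI[of _ a]) auto
  qed
  text \<open>\<open>L\<close> singles out the last point of the segment from \<open>a\<close> to \<open>b\<close> at distance at most \<open>q\<close> from \<open>a\<close>,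
    which catches the end points of edges; \<open>W\<close> catches interior points of intervals that are not edges.\<close>
  define L where "L a b q z \<longleftrightarrow> z \<in> M \<and> d a z + d z b = d a b \<and> d a z \<le> q \<and>
      (\<forall>w\<in>M. d a w + d w b = d a b \<and> d a w \<le> q \<longrightarrow> d a w \<le> d a z)" for a b q z
  define W where "W a b q r z \<longleftrightarrow> z \<in> M \<and> d a z + d z b = d a b \<and> q < d a z \<and> d a z < r" for a b q r z
  define D where "D = M \<inter> ((\<lambda>(a,b,q). SOME z. L a b q z) ` (Q \<times> Q \<times> \<rat>)
      \<union> (\<lambda>(a,b,q,r). SOME z. W a b q r z) ` (Q \<times> Q \<times> \<rat> \<times> \<rat>))"
  have "countable D"
    unfolding D_def using \<open>countable Q\<close> by (simp add: countable_rat)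
  moreover have "D \<subseteq> M" by (simp add: D_def)
  moreover have "\<exists>p\<in>D. d x p + d p y = d x y \<and> p \<noteq> y" if x: "x \<in> M" and y: "y \<in> M" and "x \<noteq> y" for x y
  proof (cases "\<exists>m\<in>M. d x m + d m y = d x y \<and> m \<noteq> x \<and> m \<noteq> y")
    case False
    have pos: "d x y > 0" using x y \<open>x \<noteq> y\<close> by simp
    \<comment> \<open>Nothing lies strictly between \<open>x\<close> and \<open>y\<close>, so this
      radius makes \<open>a\<close> project to \<open>x\<close> and \<open>b\<close> to
      \<open>y\<close>; the segment from \<open>a\<close> to \<open>b\<close> passes
      \<open>x\<close> and then \<open>y\<close>.\<close>
    obtain a b where a: "a \<in> Q" "d a x < d x y" and b: "b \<in> Q" "d b y < d x y"
      using dense pos x y by meson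
    have M: "a \<in> M" "b \<in> M" using a b QM by auto
    have "c x y a = x"
      using False branch_between[of x y a] M x y a commute by (smt (verit) branch_in nonneg)
    then have ax: "d a x + d x y = d a y"
      using branch_between(3)[of x y a] M x y commute by (metis add.commute)
    have "c x y b = y"
      using False branch_between[of x y b] M x y b commute by (smt (verit) branch_in nonneg)
    then have yb: "d x y + d y b = d x b"
      using branch_between(2)[of x y b] M x y by metis
    have ab: "d a b = d a x + d x y + d y b"
      using between_concat[OF M x y \<open>x \<noteq> y\<close> ax yb] .
    have bx: "d a x + d x b = d a b" and by': "d a y + d y b = d a b"
      using ab ax yb by linarith+
    obtain q where q: "q \<in> \<rat>" "d a x < q" "q < d a y"
      using Rats_dense_in_real[of "d a x" "d a y"] ax pos by auto
    have max: "d a w \<le> d a x" if "w \<in> M" "d a w + d w b = d a b" "d a w \<le> q" for w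
    proof (rule ccontr)
      assume less: "\<not> d a w \<le> d a x"
      have "d x w = d a w - d a x" "d w y = d a y - d a w"
        using between_dist[OF M x that(1) bx that(2)] between_dist[OF M that(1) y that(2) by'] less that(3) q
        by linarith+
      then have "d x w + d w y = d x y" using ax by linarith
      moreover have "w \<noteq> x" "w \<noteq> y" using less that(3) q by auto
      ultimately have "\<exists>m\<in>M. d x m + d m y = d x y \<and> m \<noteq> x \<and> m \<noteq> y" using that(1) by blast
      then show False using False by contradiction
    qed
    have Lx: "L a b q x" unfolding L_def using x bx q max by auto
    \<comment> \<open>The choice has to return \<open>x\<close> itself, which is why
      \<open>L\<close> demands a last point.\<close>
    have "(SOME z. L a b q z) = x"
    proof (rule some_equality)
      fix z assume z: "L a b q z"
      then have "d a z = d a x"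
        using max Lx unfolding L_def by (meson order_antisym)
      then show "z = x" using between_unique[OF M _ x _ bx] z unfolding L_def by blast
    qed (rule Lx)
    then have "x \<in> D" unfolding D_def using x a(1) b(1) q(1) by (auto intro!: rev_image_eqI[of "(a, b, q)"])
    then show ?thesis using x \<open>x \<noteq> y\<close> by (intro bexI[of _ x]) auto
  next
    case True
    then obtain m where m: "m \<in> M" "d x m + d m y = d x y" "m \<noteq> x" "m \<noteq> y" by blast
    have pos: "d x m > 0" "d m y > 0" using m x y by auto
    \<comment> \<open>These radii put the projections \<open>u\<close> of \<open>a\<close> and
      \<open>v\<close> of \<open>b\<close> strictly on either side of \<open>m\<close>.\<close>
    obtain a b where a: "a \<in> Q" "d a x < d x m" and b: "b \<in> Q" "d b y < d m y"
      using dense pos x y by meson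
    have M: "a \<in> M" "b \<in> M" using a b QM by auto
    define u where "u = c x y a"
    define v where "v = c x y b"
    have uv: "u \<in> M" "v \<in> M" using x y M by (auto simp: u_def v_def)
    have u: "d x u + d u y = d x y" "d x u + d u a = d x a" "d y u + d u a = d y a"
      unfolding u_def using branch_between x y M by blast+
    have v: "d x v + d v y = d x y" "d x v + d v b = d x b" "d y v + d v b = d y b"
      unfolding v_def using branch_between x y M by blast+
    note comm = commute[of x a] commute[of y b] commute[of y v] commute[of a u] commute[of y u] commute[of y a]
    have "d x u < d x m" "d v y < d m y"
      using u v a b comm nonneg[of u a] nonneg[of v b] by linarith+
    then have lt: "d x u < d x m" "d x m < d x v" using m(2) v(1) by linarith+
    have um: "d u m = d x m - d x u"
      using between_dist[OF x y uv(1) m(1) u(1) m(2)] lt by linarith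
    have mv: "d m v = d x v - d x m"
      using between_dist[OF x y m(1) uv(2) m(2) v(1)] lt by linarith
    have uv': "d u v = d x v - d x u"
      using between_dist[OF x y uv u(1) v(1)] lt by linarith
    have "u \<noteq> v" using lt by auto
    have auv: "d a u + d u v = d a v"
      using triangle[OF M(1) uv] triangle[OF M(1) uv(2) y] u v uv' comm by linarith
    have uvb: "d u v + d v b = d u b"
      using triangle[OF uv M(2)] triangle[OF x uv(1) M(2)] u v uv' comm by linarith
    have ab: "d a b = d a u + d u v + d v b"
      using between_concat[OF M uv \<open>u \<noteq> v\<close> auv uvb] .
    have am: "d a m + d m b = d a b" "d a m = d a u + d u m"
      using triangle[OF M(1) uv(1) m(1)] triangle[OF m(1) uv(2) M(2)] triangle[OF M(1) m(1) M(2)]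
        um mv uv' ab auv
      by linarith+
    obtain q r where qr: "q \<in> \<rat>" "d a u < q" "q < d a m" "r \<in> \<rat>" "d a m < r" "r < d a v"
    proof -
      have "d a u < d a m" "d a m < d a v" using am um mv uv' auv lt by linarith+
      then show thesis using Rats_dense_in_real[of "d a u" "d a m"] Rats_dense_in_real[of "d a m" "d a v"] that
        by blast
    qed
    \<comment> \<open>The cut-offs lie around \<open>m\<close> and inside the stretch from
      \<open>u\<close> to \<open>v\<close>, which is part of the interval. So any chosen point is in
      the interval and comes before \<open>v\<close>, hence differs from \<open>y\<close>.\<close>
    define p where "p = (SOME z. W a b q r z)"
    have "W a b q r m" unfolding W_def using m qr am by auto
    then have "W a b q r p" unfolding p_def by (rule someI)
    then have p: "p \<in> M" "d a p + d p b = d a b" "q < d a p" "d a p < r"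
      by (auto simp: W_def)
    then have "p \<in> D" unfolding D_def p_def using a(1) b(1) qr(1,4) by (auto intro!: rev_image_eqI[of "(a, b, q, r)"])
    have "d a u + d u b = d a b" "d a v + d v b = d a b" using ab auv uvb by linarith+
    then have upv: "d u p = d a p - d a u" "d p v = d a v - d a p"
      using between_dist[OF M uv(1) p(1) _ p(2)] between_dist[OF M p(1) uv(2) p(2)] p qr by linarith+
    have "d x p + d p y = d x y"
      using triangle[OF x uv(1) p(1)] triangle[OF p(1) uv(2) y] triangle[OF x p(1) y] upv u v auv uv' by linarith
    moreover have "p \<noteq> y"
    proof
      assume "p = y"
      then have "d a y < d a v" using p(4) qr(6) by simp
      then show False using u v auv uv' comm nonneg[of v y] by linarith
    qed
    ultimately show ?thesis using \<open>p \<in> D\<close> by blast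
  qed
  ultimately show ?thesis
    unfolding order_separable_def
    by (intro exI[of _ D]) (fastforce simp: tree_interval_metric)
qed

end

section \<open>Connectedness and compactness: geodesics, absence of edges, suprema\<close>

lemma (in real_tree) geodesic:
  assumes x: "x \<in> M" and y: "y \<in> M" and t: "0 \<le> t" "t \<le> d x y"
  shows "\<exists>z\<in>M. d x z = t \<and> d z y = d x y - t"
proof (rule ccontr)
  assume no: "\<not> ?thesis"
  then have "t \<noteq> 0" "t \<noteq> d x y" using x y by auto
  then have t: "0 < t" "t < d x y" using t by auto
  text \<open>In the ambient tree \<open>g z\<close> is the position of the projection of \<open>z\<close> to the segment from \<open>x\<close> to
    \<open>y\<close>, and \<open>h z\<close> is the distance of \<open>z\<close> to that segment. If no point has \<open>g = t\<close> and \<open>h = 0\<close>, then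
    the ball of radius \<open>h z\<close> about a point with \<open>g z = t\<close> contains no point with \<open>g < t\<close>, so that
    \<open>{g < t}\<close> and \<open>{g \<ge> t}\<close> separate the space.\<close>
  define g where "g z = (d x z + d x y - d y z) / 2" for z
  define h where "h z = (d x z + d y z - d x y) / 2" for z
  have lip: "\<bar>g z - g w\<bar> \<le> d z w" if "z \<in> M" "w \<in> M" for z w
    using triangle[of x z w] triangle[of x w z] triangle[of y z w] triangle[of y w z] that x y commute[of z w]
    unfolding g_def by (simp add: abs_le_iff field_simps)
  have opU: "openin mtopology {z \<in> M. g z < t}"
    unfolding openin_mtopology
  proof (intro conjI ballI; clarsimp)
    fix z assume z: "z \<in> M" "g z < t"
    show "\<exists>r>0. mball z r \<subseteq> {z \<in> M. g z < t}"
      using z lip by (intro exI[of _ "t - g z"]) (fastforce simp: abs_le_iff)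
  qed
  have opV: "openin mtopology {z \<in> M. g z \<ge> t}"
    unfolding openin_mtopology
  proof (intro conjI ballI; clarsimp)
    fix z assume z: "z \<in> M" "t \<le> g z"
    show "\<exists>r>0. mball z r \<subseteq> {z \<in> M. t \<le> g z}"
    proof (cases "g z = t")
      case False
      then show ?thesis
        using z lip by (intro exI[of _ "g z - t"]) (fastforce simp: abs_le_iff)
    next
      case True
      have h0: "h w \<ge> 0" if "w \<in> M" for w
        using triangle[of x w y] x y that commute[of w y] by (simp add: h_def)
      have "h z \<noteq> 0"
        using no z True commute[of y z] by (auto simp: h_def g_def field_simps)
      then have "h z > 0" using h0 z by force
      moreover have "g w \<ge> t" if w: "w \<in> M" "d z w < h z" for w
      proof (rule ccontr)
        assume "\<not> g w \<ge> t"
        \<comment> \<open>Here \<open>d x z = g z + h z\<close> and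
          \<open>d y z = d x y - g z + h z\<close>, likewise for \<open>w\<close>. As
          \<open>g w < g z\<close>, the second sum is below the left-hand side, so the first one is
          the bound.\<close>
        moreover have "d x z + d y w \<le> max (d x y + d z w) (d x w + d z y)"
          using four_point[of x z y w] x y z w by blast
        ultimately have "d z w \<ge> h z + h w"
          using True commute[of z y] by (auto simp: h_def g_def field_simps)
        then show False using w h0 by force
      qed
      ultimately show ?thesis by (intro exI[of _ "h z"]) auto
    qed
  qed
  have "x \<in> {z \<in> M. g z < t}" "y \<in> {z \<in> M. g z \<ge> t}"
    using t x y commute[of y x] by (auto simp: g_def)
  moreover have "{z \<in> M. g z < t} \<inter> {z \<in> M. g z \<ge> t} = {}"
    "topspace mtopology \<subseteq> {z \<in> M. g z < t} \<union> {z \<in> M. g z \<ge> t}" by auto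
  ultimately show False
    using connected opU opV unfolding connected_space_def by blast
qed

text \<open>The branch point is the point at the Gromov product distance \<open>t\<close> on a
  geodesic from \<open>x\<close> to \<open>y\<close>. There the two right-hand sums of the
  four-point condition agree and bound \<open>d z m\<close>; the triangle inequality gives
  equality.\<close>

lemma (in real_tree) metric_tree: "metric_tree M d"
proof
  fix x y z assume xyz: "x \<in> M" "y \<in> M" "z \<in> M"
  define t where "t = (d x y + d x z - d y z) / 2"
  have "0 \<le> t" "t \<le> d x y"
    unfolding t_def using xyz triangle[of y x z] triangle[of x y z] commute[of y x] by auto
  then obtain m where m: "m \<in> M" "d x m = t" "d m y = d x y - t"
    using geodesic xyz by blast
  have "d x y + d z m \<le> max (d x z + d y m) (d x m + d y z)"
    using four_point[of x y z m] xyz m by blast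
  then show "\<exists>m. is_metric_branch_point M d x y z m"
    unfolding is_metric_branch_point_def
    using m xyz commute[of y m] commute[of z m] triangle[of x m z] triangle[of y m z]
    by (intro exI[of _ m]) (auto simp: t_def field_simps)
qed

text \<open>Midpoints rule out edges. The upper sets \<open>I x\<close> of the members of a chain
  and the lower sets \<open>J u\<close> of its upper bounds are closed with the finite intersection
  property; a common point is the supremum.\<close>

lemma (in metric_tree_map) algebraic_continuum_tree:
  assumes conn: "connected_space mtopology" and comp: "compact_space mtopology"
  shows "algebraic_continuum_tree M c"
proof -
  interpret real_tree M d by unfold_locales (rule conn)
  interpret algebraic_tree M c by (rule algebraic_tree)
  show ?thesis
  proof
    have "tree_interval M c x y \<noteq> {x, y}" if xy: "x \<in> M" "y \<in> M" "x \<noteq> y" for x y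
    proof -
      have "d x y > 0" using xy by simp
      obtain z where z: "z \<in> M" "d x z = d x y / 2" "d z y = d x y - d x y / 2"
        using geodesic[of x y "d x y / 2"] xy \<open>d x y > 0\<close> by auto
      then have "z \<noteq> x" "z \<noteq> y" using \<open>d x y > 0\<close> xy by auto
      then show ?thesis using z xy tree_interval_metric by auto
    qed
    then show "tree_edges M c = {}" by (auto simp: tree_edges_def)
    show "order_complete M c"
      unfolding order_complete_def
    proof (intro ballI allI impI, elim conjE)
      fix \<rho> C assume \<rho>: "\<rho> \<in> M" and C: "C \<subseteq> M" "C \<noteq> {}" and ch: "Complete_Partial_Order.chain (tree_le M c \<rho>) C"
      have le: "tree_le M c \<rho> x y \<longleftrightarrow> x \<in> M \<and> d \<rho> x + d x y = d \<rho> y" if "y \<in> M" for x y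
        using that \<rho> by (simp add: tree_le_def tree_interval_metric)
      define I where "I x = {y \<in> M. d \<rho> x + d x y = d \<rho> y}" for x
      define J where "J u = {y \<in> M. d \<rho> y + d y u = d \<rho> u}" for u
      define ub where "ub = {u \<in> M. \<forall>x\<in>C. tree_le M c \<rho> x u}"
      have cont: "continuous_map mtopology euclideanreal (\<lambda>z. d a z)"
        "continuous_map mtopology euclideanreal (\<lambda>z. d z a)" if "a \<in> M" for a
        using continuous_map_mdist_alt[of mtopology "metric (M, d)" "\<lambda>z. (a, z)"]
          continuous_map_mdist_alt[of mtopology "metric (M, d)" "\<lambda>z. (z, a)"] that
        by (auto simp: mtopology_of continuous_map_pairedI)
      have clI: "closedin mtopology (I x)" if "x \<in> M" for x
        using closedin_continuous_map_preimage[OF continuous_map_diff[OF continuous_map_add[OF _ cont(1)[OF that]] cont(1)[OF \<rho>]],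
            of "\<lambda>_. d \<rho> x" "{0}"]
        by (simp add: I_def)
      have clJ: "closedin mtopology (J u)" if "u \<in> M" for u
        using closedin_continuous_map_preimage[OF continuous_map_add[OF cont(1)[OF \<rho>] cont(2)[OF that]],
            of "{d \<rho> u}"]
        by (simp add: J_def)
      \<comment> \<open>A finite intersection even contains a tail of the chain: \<open>J u\<close>
        contains all of \<open>C\<close>, and \<open>I x\<close> the part of \<open>C\<close> above
        \<open>x\<close>.\<close>
      have tail: "\<exists>x0\<in>C. \<forall>y\<in>C. tree_le M c \<rho> x0 y \<longrightarrow> y \<in> \<Inter>\<F>" if "finite \<F>" "\<F> \<subseteq> I ` C \<union> J ` ub" for \<F>
        using that
      proof (induction \<F>)
        case empty
        then show ?case using C by auto
      next
        case (insert K \<F>)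
        then obtain x0 where x0: "x0 \<in> C" "\<And>y. y \<in> C \<Longrightarrow> tree_le M c \<rho> x0 y \<Longrightarrow> y \<in> \<Inter>\<F>" by auto
        have tr: "tree_le M c \<rho> x z" if "tree_le M c \<rho> x y" "tree_le M c \<rho> y z" "z \<in> M" for x y z
        proof -
          have "y \<in> M" using that(2,3) le by blast
          then show ?thesis
            using that le[of y x] le[of z y] le[of z x] \<rho> triangle[of \<rho> x z] triangle[of x y z] by auto
        qed
        from insert.prems consider x where "x \<in> C" "K = I x" | u where "u \<in> ub" "K = J u" by auto
        then show ?case
        proof cases
          case 1
          have K: "y \<in> K" if "y \<in> C" "tree_le M c \<rho> x y" for y
            using that 1 C le by (auto simp: I_def)
          consider "tree_le M c \<rho> x0 x" | "tree_le M c \<rho> x x0"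
            using ch 1 x0 by (auto simp: chain_def)
          then show ?thesis
          proof cases
            assume x0x: "tree_le M c \<rho> x0 x"
            have "y \<in> \<Inter>(insert K \<F>)" if "y \<in> C" "tree_le M c \<rho> x y" for y
              using K[OF that] x0(2)[OF that(1) tr[OF x0x that(2)]] that(1) C(1) by blast
            then show ?thesis using 1 by blast
          next
            assume xx0: "tree_le M c \<rho> x x0"
            have "y \<in> \<Inter>(insert K \<F>)" if "y \<in> C" "tree_le M c \<rho> x0 y" for y
              using K[OF that(1) tr[OF xx0 that(2)]] x0(2)[OF that] that(1) C(1) by blast
            then show ?thesis using x0(1) by blast
          qed
        next
          case 2
          have "y \<in> K" if "y \<in> C" for y
            using that 2 C le by (auto simp: J_def ub_def)
          then show ?thesis using x0 by auto
        qed
      qed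
      have "\<Inter>(I ` C \<union> J ` ub) \<noteq> {}"
      proof (rule comp[unfolded compact_space_fip, rule_format])
        show "(\<forall>K\<in>I ` C \<union> J ` ub. closedin mtopology K) \<and>
          (\<forall>\<F>. finite \<F> \<and> \<F> \<subseteq> I ` C \<union> J ` ub \<longrightarrow> \<Inter>\<F> \<noteq> {})"
        proof (intro conjI ballI allI impI)
          fix K assume "K \<in> I ` C \<union> J ` ub"
          then show "closedin mtopology K" using clI clJ C ub_def by auto
        next
          fix \<F> assume F: "finite \<F> \<and> \<F> \<subseteq> I ` C \<union> J ` ub"
          obtain x0 where "x0 \<in> C" "tree_le M c \<rho> x0 x0 \<longrightarrow> x0 \<in> \<Inter>\<F>"
            using tail[OF conjunct1[OF F] conjunct2[OF F]] by blast
          moreover have "tree_le M c \<rho> x0 x0" using le \<open>x0 \<in> C\<close> C \<rho> by auto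
          ultimately show "\<Inter>\<F> \<noteq> {}" by blast
        qed
      qed
      then obtain s where "s \<in> \<Inter>(I ` C \<union> J ` ub)" by (auto simp del: Inter_iff Inter_Un_distrib)
      then have s: "\<And>x. x \<in> C \<Longrightarrow> s \<in> I x" "\<And>u. u \<in> ub \<Longrightarrow> s \<in> J u" by simp_all
      have "s \<in> M" using s C by (auto simp: I_def)
      then have "is_supremum M (tree_le M c \<rho>) C s"
        unfolding is_supremum_def using s C le by (auto simp: I_def J_def ub_def)
      then show "\<exists>s. is_supremum M (tree_le M c \<rho>) C s" ..
    qed
  qed
qed

section \<open>Pullback of metric structure along injections\<close>

lemma metric_tree_map_pullback:
  assumes "metric_tree_map M d c" and inj: "inj_on f T" and sub: "f ` T \<subseteq> M" and ne: "T \<noteq> {}"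
    and closed: "\<And>x y z. \<lbrakk>x \<in> T; y \<in> T; z \<in> T\<rbrakk> \<Longrightarrow> c' x y z \<in> T"
    and hom: "\<And>x y z. \<lbrakk>x \<in> T; y \<in> T; z \<in> T\<rbrakk> \<Longrightarrow> f (c' x y z) = c (f x) (f y) (f z)"
  shows "metric_tree_map T (\<lambda>x y. d (f x) (f y)) c'"
proof -
  interpret metric_tree_map M d c by fact
  have fM: "f x \<in> M" if "x \<in> T" for x using sub that by blast
  show ?thesis
  proof
    fix x y assume "x \<in> T" "y \<in> T"
    then show "d (f x) (f y) = 0 \<longleftrightarrow> x = y"
      using inj fM by (simp add: inj_on_eq_iff)
  next
    fix x y z assume "x \<in> T" "y \<in> T" "z \<in> T"
    then show "d (f x) (f z) \<le> d (f x) (f y) + d (f y) (f z)"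
      using fM triangle by blast
  next
    fix x1 x2 x3 x4 assume "x1 \<in> T" "x2 \<in> T" "x3 \<in> T" "x4 \<in> T"
    then show "d (f x1) (f x2) + d (f x3) (f x4)
        \<le> max (d (f x1) (f x3) + d (f x2) (f x4)) (d (f x1) (f x4) + d (f x2) (f x3))"
      using fM four_point by blast
  next
    fix x y z assume xyz: "x \<in> T" "y \<in> T" "z \<in> T"
    then show "is_metric_branch_point T (\<lambda>x y. d (f x) (f y)) x y z (c' x y z)"
      using closed[OF xyz] hom[OF xyz] branch_between fM by (simp add: is_metric_branch_point_def)
  qed (use ne commute in auto)
qed

text \<open>The centres of the balls must come from \<open>T\<close>, so total boundedness is passed
  to the image of \<open>T\<close> first.\<close>

lemma mtotally_bounded_pullback:
  assumes "Metric_space M d" "Metric_space T (\<lambda>x y. d (f x) (f y))"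
    and sub: "f ` T \<subseteq> M" and tb: "Metric_space.mtotally_bounded M d M"
  shows "Metric_space.mtotally_bounded T (\<lambda>x y. d (f x) (f y)) T"
proof -
  interpret M: Metric_space M d by fact
  interpret T: Metric_space T "\<lambda>x y. d (f x) (f y)" by fact
  have "M.mtotally_bounded (f ` T)"
    using M.mtotally_bounded_subset[OF tb sub] .
  show ?thesis
    unfolding T.mtotally_bounded_def
  proof (intro allI impI)
    fix e :: real assume "e > 0"
    then obtain K where K: "finite K" "K \<subseteq> f ` T" "f ` T \<subseteq> (\<Union>x\<in>K. M.mball x e)"
      using \<open>M.mtotally_bounded (f ` T)\<close> unfolding M.mtotally_bounded_def by meson
    then obtain K' where K': "K' \<subseteq> T" "finite K'" "K = f ` K'"
      by (meson finite_subset_image)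
    have "T \<subseteq> (\<Union>x\<in>K'. T.mball x e)"
    proof
      fix x assume "x \<in> T"
      then have "f x \<in> (\<Union>x\<in>K. M.mball x e)" using K(3) by blast
      then obtain k where "k \<in> K'" "f x \<in> M.mball (f k) e" using K' by blast
      then show "x \<in> (\<Union>x\<in>K'. T.mball x e)"
        using \<open>x \<in> T\<close> K' by auto
    qed
    then show "\<exists>K. finite K \<and> K \<subseteq> T \<and> T \<subseteq> (\<Union>x\<in>K. T.mball x e)"
      using K' by blast
  qed
qed

lemma mtopology_pullback:
  assumes "Metric_space M d" "Metric_space T (\<lambda>x y. d (f x) (f y))" and bij: "bij_betw f T M"
  shows "compact_space (Metric_space.mtopology M d) \<Longrightarrow>
      compact_space (Metric_space.mtopology T (\<lambda>x y. d (f x) (f y)))"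
    and "connected_space (Metric_space.mtopology M d) \<Longrightarrow>
      connected_space (Metric_space.mtopology T (\<lambda>x y. d (f x) (f y)))"
proof -
  interpret M: Metric_space M d by fact
  interpret T: Metric_space T "\<lambda>x y. d (f x) (f y)" by fact
  define g where "g = inv_into T f"
  have g: "g y \<in> T" "f (g y) = y" if "y \<in> M" for y
    using bij that unfolding g_def by (auto simp: bij_betw_def inv_into_into f_inv_into_f)
  have gM: "g ` M = T"
    using bij unfolding g_def by (metis bij_betw_def inv_into_image_cancel subset_refl)
  have cont: "continuous_map M.mtopology T.mtopology g"
    unfolding T.continuous_map_to_metric
  proof (intro ballI allI impI)
    fix x e assume x: "x \<in> topspace M.mtopology" and e: "(e::real) > 0"
    have "M.mball x e \<subseteq> {y. g y \<in> T.mball (g x) e}" using x g by auto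
    then show "\<exists>U. openin M.mtopology U \<and> x \<in> U \<and> (\<forall>y\<in>U. g y \<in> T.mball (g x) e)"
      using x e by (intro exI[of _ "M.mball x e"]) auto
  qed
  have top: "g ` topspace M.mtopology = topspace T.mtopology" using gM by simp
  show "compact_space T.mtopology" if "compact_space M.mtopology"
    using that image_compactin[OF _ cont, of "topspace M.mtopology"] top
    by (simp add: compact_space_def)
  show "connected_space T.mtopology" if "connected_space M.mtopology"
    using that connectedin_continuous_map_image[OF cont, of "topspace M.mtopology"]
    unfolding top connectedin_topspace by blast
qed

section \<open>A compact real tree of sequences\<close>

lemma summable_unit: 
  assumes "\<And>n. 0 \<le> p n" "\<And>n. p n \<le> 1"
  shows "summable (\<lambda>n. (1/2::real)^n * p n)"
proof (rule summable_comparison_test')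
  show "summable (\<lambda>n. (1/2::real)^n)" by simp
  show "norm ((1/2)^n * p n) \<le> (1/2)^n" if "n \<ge> 0" for n
    using assms[of n] by (simp add: mult_left_le)
qed

locale gromov_matrix =
  fixes A :: "nat \<Rightarrow> nat \<Rightarrow> real"
  assumes A_sym: "A n m = A m n"
    and A_nonneg: "0 \<le> A n m"
    and A_le_1: "A n n \<le> 1"

text \<open>If \<open>A n m\<close> is the Gromov product, based at a root, of the \<open>n\<close>-th and the \<open>m\<close>-th of a sequence of
  points, then a further point of a real tree spanned by them is recorded by its Gromov products
  \<open>G n\<close> with the members of the sequence. The inequalities below are the 0-hyperbolicity conditions
  for the root, the further point and two members; the case \<open>min (G m) (A n m) \<le> G n\<close> is covered by the symmetry of \<open>A\<close>.\<close>

definition tree_model :: "(nat \<Rightarrow> nat \<Rightarrow> real) \<Rightarrow> (nat \<Rightarrow> real) set" where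
  "tree_model A = {G. \<forall>n m. 0 \<le> G n \<and> G n \<le> A n n \<and> min (G n) (G m) \<le> A n m \<and> min (G n) (A n m) \<le> G m}"

definition pmin :: "(nat \<Rightarrow> real) \<Rightarrow> (nat \<Rightarrow> real) \<Rightarrow> nat \<Rightarrow> real" where
  "pmin p q = (\<lambda>n. min (p n) (q n))"

text \<open>Written as the join of the pairwise meets, since the branch point in a rooted tree is
  the largest of the three meets.\<close>

definition pmedian :: "(nat \<Rightarrow> real) \<Rightarrow> (nat \<Rightarrow> real) \<Rightarrow> (nat \<Rightarrow> real) \<Rightarrow> nat \<Rightarrow> real" where
  "pmedian p q r = (\<lambda>n. max (max (min (p n) (q n)) (min (p n) (r n))) (min (q n) (r n)))"

lemma pmin_le: "pmin p q \<le> p" "pmin p q \<le> q"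
  by (auto simp: pmin_def le_fun_def)

lemma le_pmin: "r \<le> p \<Longrightarrow> r \<le> q \<Longrightarrow> r \<le> pmin p q"
  by (auto simp: pmin_def le_fun_def)

lemma pmin_commute: "pmin p q = pmin q p"
  by (auto simp: pmin_def min.commute)

context gromov_matrix
begin

lemma tree_modelD:
  assumes "G \<in> tree_model A"
  shows "0 \<le> G n" "G n \<le> A n n" "min (G n) (G m) \<le> A n m" "min (G n) (A n m) \<le> G m" "G n \<le> 1"
proof -
  show "0 \<le> G n" "min (G n) (G m) \<le> A n m" "min (G n) (A n m) \<le> G m" and "G n \<le> A n n"
    using assms unfolding tree_model_def by blast+
  then show "G n \<le> 1" using A_le_1[of n] by linarith
qed

lemma zero_in_model: "(\<lambda>n. 0) \<in> tree_model A"
  using A_nonneg by (simp add: tree_model_def min_le_iff_disj)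

lemma pmin_in_model:
  assumes p: "p \<in> tree_model A" and q: "q \<in> tree_model A"
  shows "pmin p q \<in> tree_model A"
  unfolding tree_model_def pmin_def
proof (intro CollectI allI conjI)
  fix n m
  show "0 \<le> min (p n) (q n)" "min (p n) (q n) \<le> A n n"
    "min (min (p n) (q n)) (min (p m) (q m)) \<le> A n m"
    "min (min (p n) (q n)) (A n m) \<le> min (p m) (q m)"
    using tree_modelD(1,2)[OF p, of n] tree_modelD(3,4)[OF p, of n m]
      tree_modelD(1,2)[OF q, of n] tree_modelD(3,4)[OF q, of n m] by linarith+
qed

lemma truncation_in_model:
  assumes "G \<in> tree_model A" "0 \<le> t"
  shows "(\<lambda>n. min t (G n)) \<in> tree_model A"
  unfolding tree_model_def
proof (intro CollectI allI conjI)
  fix n m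
  show "0 \<le> min t (G n)" "min t (G n) \<le> A n n" "min (min t (G n)) (min t (G m)) \<le> A n m"
    "min (min t (G n)) (A n m) \<le> min t (G m)"
    using tree_modelD(1,2)[OF assms(1), of n] tree_modelD(3,4)[OF assms(1), of n m] assms(2) by linarith+
qed

text \<open>If \<open>G n < H n\<close> and \<open>H m < G m\<close>, the common bound
  \<open>K\<close> gives \<open>min (H n) (G m) \<le> A n m\<close>. The conditions on
  \<open>G\<close> and \<open>H\<close> then yield \<open>G m \<le> G n\<close> and
  \<open>H n \<le> H m\<close>, a cycle containing strict inequalities.\<close>

lemma model_chain:
  assumes "G \<in> tree_model A" "H \<in> tree_model A" "K \<in> tree_model A" "G \<le> K" "H \<le> K"
  shows "G \<le> H \<or> H \<le> G"
proof (rule ccontr)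
  assume "\<not> ?thesis"
  then obtain n m where nm: "G n < H n" "H m < G m"
    by (auto simp: le_fun_def not_le)
  have "H n \<le> K n" "G m \<le> K m" using assms by (auto simp: le_fun_def)
  then show False
    using nm tree_modelD(3,4)[OF assms(1), of n m] tree_modelD(4)[OF assms(1), of m n]
      tree_modelD(3,4)[OF assms(2), of n m] tree_modelD(4)[OF assms(2), of m n]
      tree_modelD(3)[OF assms(3), of n m] A_sym[of m n]
    by linarith
qed

lemma pmin_chain:
  assumes "p \<in> tree_model A" "q \<in> tree_model A" "r \<in> tree_model A"
  shows "pmin p q \<le> pmin p r \<or> pmin p r \<le> pmin p q"
  using model_chain[of "pmin p q" "pmin p r" p] assms pmin_in_model pmin_le by blast

text \<open>Any two of the three minima lie below a common argument, hence are comparable; the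
  supremum of all three is therefore one of them.\<close>

lemma pmedian_cases:
  assumes "p \<in> tree_model A" "q \<in> tree_model A" "r \<in> tree_model A"
  shows "pmedian p q r \<in> {pmin p q, pmin p r, pmin q r}"
proof -
  have eq: "pmedian p q r = sup (sup (pmin p q) (pmin p r)) (pmin q r)"
    by (simp add: pmedian_def pmin_def sup_fun_def sup_max)
  have "pmin p q \<le> pmin p r \<or> pmin p r \<le> pmin p q" "pmin p q \<le> pmin q r \<or> pmin q r \<le> pmin p q"
    "pmin p r \<le> pmin q r \<or> pmin q r \<le> pmin p r"
    using pmin_chain[of p q r] pmin_chain[of q p r] pmin_chain[of r p q] assms pmin_commute by metis+
  then show ?thesis unfolding eq
    by (auto simp: sup_absorb1 sup_absorb2)
qed

lemma pmedian_in_model: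
  assumes "p \<in> tree_model A" "q \<in> tree_model A" "r \<in> tree_model A"
  shows "pmedian p q r \<in> tree_model A"
  using pmedian_cases[OF assms] pmin_in_model assms by auto

text \<open>The library metric on \<open>nat \<Rightarrow> real\<close> sums the coordinate distances, cut off at \<open>1\<close>, with weights
  \<open>(1/2)^n\<close>. The cut-off is inactive on the model, so that the metric is additive along coordinatewise
  monotone segments, and \<open>height p\<close> is the distance of \<open>p\<close> to the root \<open>0\<close>.\<close>

definition height :: "(nat \<Rightarrow> real) \<Rightarrow> real" where
  "height p = (\<Sum>n. (1/2)^n * p (from_nat n))"

lemma summable_model: "p \<in> tree_model A \<Longrightarrow> summable (\<lambda>n. (1/2)^n * p (from_nat n))"
  by (rule summable_unit) (auto intro: tree_modelD)

lemma height_mono: "\<lbrakk>p \<in> tree_model A; q \<in> tree_model A; p \<le> q\<rbrakk> \<Longrightarrow> height p \<le> height q"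
  unfolding height_def by (intro suminf_le summable_model) (auto simp: le_fun_def)

lemma dist_model:
  assumes "p \<in> tree_model A" "q \<in> tree_model A"
  shows "dist p q = (\<Sum>n. (1/2)^n * \<bar>p (from_nat n) - q (from_nat n)\<bar>)"
    and "summable (\<lambda>n. (1/2)^n * \<bar>p (from_nat n) - q (from_nat n)\<bar>)"
proof -
  have le: "\<bar>p n - q n\<bar> \<le> 1" for n
    using tree_modelD(1,5)[OF assms(1), of n] tree_modelD(1,5)[OF assms(2), of n] by linarith
  then show "dist p q = (\<Sum>n. (1/2)^n * \<bar>p (from_nat n) - q (from_nat n)\<bar>)"
    unfolding dist_fun_def dist_real_def by (simp add: min_absorb1)
  show "summable (\<lambda>n. (1/2)^n * \<bar>p (from_nat n) - q (from_nat n)\<bar>)"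
    using le by (intro summable_unit) auto
qed

text \<open>Comes from summing \<open>\<bar>a - b\<bar> = a + b - 2 * min a b\<close>, and
  identifies \<open>height (pmin p q)\<close> as the Gromov product of \<open>p\<close> and
  \<open>q\<close> based at the root.\<close>

lemma dist_model_height:
  assumes p: "p \<in> tree_model A" and q: "q \<in> tree_model A"
  shows "dist p q = height p + height q - 2 * height (pmin p q)"
proof -
  note s = summable_model[OF p] summable_model[OF q] summable_model[OF pmin_in_model[OF p q]]
  have "height p + height q - 2 * height (pmin p q)
      = (\<Sum>n. (1/2)^n * p (from_nat n) + (1/2)^n * q (from_nat n) - 2 * ((1/2)^n * pmin p q (from_nat n)))"
    unfolding height_def
    by (intro sums_unique sums_diff sums_add sums_mult summable_sums s)
  also have "\<dots> = (\<Sum>n. (1/2)^n * \<bar>p (from_nat n) - q (from_nat n)\<bar>)"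
    by (rule suminf_cong) (auto simp: pmin_def min_def algebra_simps)
  finally show ?thesis using dist_model(1)[OF p q] by simp
qed

lemma dist_between:
  assumes p: "p \<in> tree_model A" and q: "q \<in> tree_model A" and m: "m \<in> tree_model A"
    and btw: "\<And>n. \<bar>p n - m n\<bar> + \<bar>m n - q n\<bar> = \<bar>p n - q n\<bar>"
  shows "dist p m + dist m q = dist p q"
proof -
  have "dist p m + dist m q = (\<Sum>n. (1/2)^n * \<bar>p (from_nat n) - m (from_nat n)\<bar>
      + (1/2)^n * \<bar>m (from_nat n) - q (from_nat n)\<bar>)"
    using suminf_add[OF dist_model(2)[OF p m] dist_model(2)[OF m q]] dist_model(1) p q m by simp
  also have "\<dots> = dist p q"
    unfolding dist_model(1)[OF p q] by (simp add: btw flip: distrib_left)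
  finally show ?thesis .
qed

text \<open>Both \<open>pmin p q\<close> and \<open>pmin q r\<close> lie below \<open>q\<close>, so
  they are comparable, and the smaller one lies below \<open>p\<close> and \<open>r\<close>.\<close>

lemma height_ultra:
  assumes "p \<in> tree_model A" "q \<in> tree_model A" "r \<in> tree_model A"
  shows "min (height (pmin p q)) (height (pmin q r)) \<le> height (pmin p r)"
proof -
  have "pmin p q \<le> pmin p r \<or> pmin q r \<le> pmin p r"
    using pmin_chain[of q p r] assms le_pmin pmin_le pmin_commute by (metis order_trans)
  then show ?thesis
    using height_mono pmin_in_model assms by (meson min.coboundedI1 min.coboundedI2)
qed

lemma metric_tree_map_model: "metric_tree_map (tree_model A) dist pmedian"
proof
  fix x1 x2 x3 x4 assume x: "x1 \<in> tree_model A" "x2 \<in> tree_model A" "x3 \<in> tree_model A" "x4 \<in> tree_model A"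
  define u where "u p q = height (pmin p q)" for p q
  have sym: "u p q = u q p" for p q by (simp add: u_def pmin_commute)
  have ul: "min (u p q) (u q r) \<le> u p r"
    if "p \<in> tree_model A" "q \<in> tree_model A" "r \<in> tree_model A" for p q r
    using height_ultra[OF that] by (simp add: u_def)
  have "min (u x1 x3 + u x2 x4) (u x1 x4 + u x2 x3) \<le> u x1 x2 + u x3 x4"
    using ul[OF x(1,3,2)] ul[OF x(1,4,2)] ul[OF x(3,1,4)] ul[OF x(3,2,4)]
      sym[of x3 x1] sym[of x3 x2] sym[of x4 x2]
    by linarith
  then show "dist x1 x2 + dist x3 x4 \<le> max (dist x1 x3 + dist x2 x4) (dist x1 x4 + dist x2 x3)"
    unfolding u_def dist_model_height[OF x(1,2)] dist_model_height[OF x(3,4)] dist_model_height[OF x(1,3)]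
      dist_model_height[OF x(2,4)] dist_model_height[OF x(1,4)] dist_model_height[OF x(2,3)] by linarith
next
  fix p q r assume x: "p \<in> tree_model A" "q \<in> tree_model A" "r \<in> tree_model A"
  let ?m = "pmedian p q r"
  have m: "?m \<in> tree_model A" using pmedian_in_model x by simp
  have btw: "\<bar>p n - ?m n\<bar> + \<bar>?m n - q n\<bar> = \<bar>p n - q n\<bar>"
    "\<bar>p n - ?m n\<bar> + \<bar>?m n - r n\<bar> = \<bar>p n - r n\<bar>"
    "\<bar>q n - ?m n\<bar> + \<bar>?m n - r n\<bar> = \<bar>q n - r n\<bar>" for n
    unfolding pmedian_def by (auto simp: max_def min_def)
  have "dist p ?m + dist ?m q = dist p q" "dist p ?m + dist ?m r = dist p r" "dist q ?m + dist ?m r = dist q r"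
    using dist_between[OF x(1,2) m btw(1)] dist_between[OF x(1,3) m btw(2)] dist_between[OF x(2,3) m btw(3)] .
  then show "is_metric_branch_point (tree_model A) dist p q r ?m"
    using m by (simp add: is_metric_branch_point_def)
qed (use zero_in_model in \<open>auto simp: dist_commute intro: dist_triangle\<close>)

lemma mtopology_model: "Metric_space.mtopology (tree_model A) dist = top_of_set (tree_model A)"
proof -
  interpret Submetric UNIV dist "tree_model A"
    by unfold_locales simp
  show ?thesis using mtopology_submetric by simp
qed

lemma compact_model: "compact_space (Metric_space.mtopology (tree_model A) dist)"
proof -
  have "compactin (product_topology (\<lambda>i::nat. euclideanreal) UNIV) (\<Pi>\<^sub>E i\<in>UNIV. {0..1})"
    by (simp add: compactin_PiE)
  then have cpt: "compact (\<Pi>\<^sub>E i\<in>(UNIV::nat set). {0..1::real})"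
    by (simp add: euclidean_product_topology)
  have "closed (tree_model A)"
    unfolding tree_model_def
    by (intro closed_Collect_all closed_Collect_conj closed_Collect_le continuous_intros
        continuous_on_product_coordinates)
  moreover have "tree_model A \<subseteq> (\<Pi>\<^sub>E i\<in>(UNIV::nat set). {0..1::real})"
    using tree_modelD by auto
  ultimately have "compact (tree_model A)"
    using cpt compact_Int_closed by (metis inf.absorb2)
  then show ?thesis
    by (simp add: mtopology_model compact_space_subtopology)
qed

lemma connected_model: "connected_space (Metric_space.mtopology (tree_model A) dist)"
proof -
  have conn: "\<exists>C. connected C \<and> C \<subseteq> tree_model A \<and> (\<lambda>n. 0) \<in> C \<and> G \<in> C" if G: "G \<in> tree_model A" for G
  proof (intro exI conjI)
    let ?C = "(\<lambda>t n. min t (G n)) ` {0..1::real}"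
    have "continuous_on {0..1} (\<lambda>(t::real) n. min t (G n))"
      by (intro continuous_on_coordinatewise_then_product continuous_intros)
    then show "connected ?C" by (intro connected_continuous_image) auto
    show "?C \<subseteq> tree_model A" using truncation_in_model[OF G] by auto
    have "(\<lambda>n. 0) = (\<lambda>n. min 0 (G n))" using tree_modelD[OF G] by (simp add: min_absorb1)
    then show "(\<lambda>n. 0) \<in> ?C" by force
    have "G = (\<lambda>n. min 1 (G n))" using tree_modelD[OF G] by (simp add: min_absorb2)
    then show "G \<in> ?C" by force
  qed
  have "connected (tree_model A)"
    unfolding connected_iff_connected_component
  proof (intro ballI)
    fix p q assume "p \<in> tree_model A" "q \<in> tree_model A"
    then have "connected_component (tree_model A) (\<lambda>n. 0) p" "connected_component (tree_model A) (\<lambda>n. 0) q"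
      using conn unfolding connected_component_def by blast+
    then show "connected_component (tree_model A) p q"
      by (meson connected_component_sym connected_component_trans)
  qed
  then show ?thesis
    by (simp add: mtopology_model connectedin_def flip: connectedin_iff_connected)
qed

end

section \<open>Sums with geometric weights of total weight 1\<close>

definition wsum :: "(nat \<Rightarrow> real) \<Rightarrow> real" where
  "wsum f = (\<Sum>k. (1/2)^Suc k * f k)"

lemma summable_wsum:
  assumes "\<And>k. 0 \<le> f k" "\<And>k. f k \<le> 1"
  shows "summable (\<lambda>k. (1/2::real)^Suc k * f k)"
  using summable_mult[OF summable_unit[OF assms], of "1/2"] by (simp add: mult.assoc)

lemma wsum_mono:
  assumes "\<And>k. 0 \<le> f k" "\<And>k. f k \<le> g k" "\<And>k. g k \<le> 1"
  shows "wsum f \<le> wsum g"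
proof -
  have "f k \<le> 1" "0 \<le> g k" for k using assms[of k] by linarith+
  then show ?thesis
    unfolding wsum_def using assms by (intro suminf_le summable_wsum mult_left_mono) auto
qed

lemma wsum_bounds:
  assumes "\<And>k. 0 \<le> f k" "\<And>k. f k \<le> 1"
  shows "0 \<le> wsum f" "wsum f \<le> 1"
proof -
  have "wsum (\<lambda>_. 0) = 0" "wsum (\<lambda>_. 1) = 1"
    unfolding wsum_def using power_half_series sums_unique by fastforce+
  then show "0 \<le> wsum f" "wsum f \<le> 1"
    using wsum_mono[of "\<lambda>_. 0" f] wsum_mono[of f "\<lambda>_. 1"] assms by auto
qed

lemma wsum_strict:
  assumes "\<And>k. 0 \<le> f k" "\<And>k. f k \<le> g k" "\<And>k. g k \<le> 1" and "f j < g j"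
  shows "wsum f < wsum g"
proof -
  have fg: "f k \<le> 1" "0 \<le> g k" for k using assms(1-3)[of k] by linarith+
  have "0 < (\<Sum>k. (1/2)^Suc k * g k - (1/2)^Suc k * f k)"
  proof (rule suminf_pos2[where i = j])
    show "summable (\<lambda>k. (1/2)^Suc k * g k - (1/2)^Suc k * f k)"
      using assms fg by (intro summable_diff summable_wsum)
    show "0 < (1/2)^Suc j * g j - (1/2)^Suc j * f j"
      using assms(4) by simp
  qed (use assms in auto)
  also have "\<dots> = wsum g - wsum f"
    unfolding wsum_def by (rule suminf_diff[symmetric]; rule summable_wsum; rule fg assms)
  finally show ?thesis by simp
qed

text \<open>The first \<open>N\<close> terms have total weight at most 1 and contribute at most
  \<open>e\<close>; the remaining weights sum to \<open>(1/2)^N\<close>.\<close>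

lemma wsum_close:
  assumes f: "\<And>k. 0 \<le> f k" "\<And>k. f k \<le> 1" and g: "\<And>k. 0 \<le> g k" "\<And>k. g k \<le> 1"
    and "0 \<le> e" and close: "\<And>k. k < N \<Longrightarrow> \<bar>f k - g k\<bar> \<le> e"
  shows "\<bar>wsum f - wsum g\<bar> \<le> e + (1/2)^N"
proof -
  have le1: "\<bar>f k - g k\<bar> \<le> 1" for k using f[of k] g[of k] by linarith
  let ?u = "\<lambda>k. (1/2)^Suc k * \<bar>f k - g k\<bar>"
  have su: "summable ?u" using le1 by (intro summable_wsum) auto
  have half: "(\<Sum>k. (1/2::real)^Suc k) = 1" "summable (\<lambda>k. (1/2::real)^Suc k)"
    using power_half_series by (auto simp: sums_iff)
  have "wsum f - wsum g = (\<Sum>k. (1/2)^Suc k * (f k - g k))"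
    unfolding wsum_def suminf_diff[OF summable_wsum[OF f] summable_wsum[OF g]]
    by (simp add: right_diff_distrib)
  also have "\<bar>\<dots>\<bar> \<le> suminf ?u"
    using summable_rabs[of "\<lambda>k. (1/2)^Suc k * (f k - g k)"] su by (simp add: abs_mult)
  also have "\<dots> = (\<Sum>k. ?u (k + N)) + sum ?u {..<N}"
    by (rule suminf_split_initial_segment[OF su])
  also have "(\<Sum>k. ?u (k + N)) \<le> (\<Sum>k. (1/2)^N * (1/2)^Suc k)"
  proof (rule suminf_le)
    show "summable (\<lambda>k. ?u (k + N))" using su by (rule summable_ignore_initial_segment)
    show "summable (\<lambda>k. (1/2::real)^N * (1/2)^Suc k)" using half(2) by (rule summable_mult)
    show "?u (k + N) \<le> (1/2)^N * (1/2)^Suc k" for k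
      using le1[of "k + N"] mult_left_mono[OF le1[of "k + N"], of "(1/2)^Suc (k + N)"]
      by (simp add: power_add mult_ac)
  qed
  also have "(\<Sum>k. (1/2::real)^N * (1/2)^Suc k) = (1/2)^N"
    using suminf_mult[OF half(2), of "(1/2)^N"] half(1) by simp
  also have "sum ?u {..<N} \<le> (\<Sum>k<N. (1/2)^Suc k * e)"
    using close by (intro sum_mono mult_left_mono) auto
  also have "\<dots> = (\<Sum>k<N. (1/2)^Suc k) * e" by (simp add: sum_distrib_right)
  also have "\<dots> \<le> 1 * e"
    using sum_le_suminf[OF half(2), of "{..<N}"] half(1) \<open>0 \<le> e\<close> by (intro mult_right_mono) auto
  finally show ?thesis by simp
qed

section \<open>Rooted trees and their embedding\<close>

text \<open>The four-point axiom for \<open>\<rho>\<close>, \<open>y\<close>, \<open>x\<close>,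
  \<open>z\<close> leaves only \<open>c y x z = x\<close> to treat. Then the axiom for
  \<open>\<rho>\<close>, \<open>z\<close>, \<open>x\<close>, \<open>y\<close> leaves
  \<open>y\<close> as the only alternative to \<open>x\<close>, and \<open>c \<rho> z x = y\<close>
  would put \<open>y\<close> below \<open>x\<close>, so that \<open>x = y\<close>.\<close>

lemma (in algebraic_tree) interval_trans:
  assumes "\<rho> \<in> T" "x \<in> T" "y \<in> T" "z \<in> T" "c \<rho> y x = x" "c \<rho> z y = y"
  shows "c \<rho> z x = x"
proof -
  have "c \<rho> y x \<in> {c \<rho> y z, c \<rho> x z, c y x z}"
    using four_point[of \<rho> y x z] assms by simp
  then consider "x = y" | "c \<rho> z x = x" | "c y x z = x"
    using assms sym23[of \<rho> y z] sym23[of \<rho> x z] by auto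
  then show ?thesis
  proof cases
    case 3
    have "c \<rho> z x \<in> {c \<rho> z y, c \<rho> x y, c z x y}"
      using four_point[of \<rho> z x y] assms by simp
    moreover have "c z x y = x"
      using 3 assms sym12[of z x y] sym23[of x z y] sym12[of x y z] by simp
    moreover have "x = y" if "c \<rho> z x = y"
      using three_point[of \<rho> x z] sym23[of \<rho> x z] sym23[of \<rho> x y] that assms by simp
    ultimately show ?thesis using assms sym23[of \<rho> x y] by auto
  qed (use assms in auto)
qed

lemma (in algebraic_tree) interval_suffix:
  assumes "\<rho> \<in> T" "x \<in> T" "p \<in> T" "q \<in> T" "c \<rho> x p = p" "c \<rho> p q = q"
  shows "c q x p = p"
proof -
  have q: "c \<rho> x q = q" using interval_trans[of \<rho> q p x] assms by simp
  have "c \<rho> x p \<in> {c \<rho> x q, c \<rho> p q, c x p q}"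
    using four_point[of \<rho> x p q] assms by simp
  then consider "p = q" | "c x p q = p" using q assms by auto
  then show ?thesis
  proof cases
    case 1
    then show ?thesis using two_point[of x p] sym12[of p x p] sym23[of x p p] assms by simp
  next
    case 2
    then show ?thesis using sym12[of q x p] sym23[of x q p] assms by simp
  qed
qed

locale rooted_tree = algebraic_tree +
  fixes \<rho>
  assumes root [simp]: "\<rho> \<in> T"
begin

abbreviation root_le (infix "\<preceq>" 50) where "x \<preceq> y \<equiv> tree_le T c \<rho> x y"

abbreviation meet where "meet x y \<equiv> c \<rho> x y"

declare closed [simp]

lemma root_le_iff: "x \<preceq> y \<longleftrightarrow> x \<in> T \<and> c \<rho> y x = x"
  by (simp add: tree_le_def tree_interval_def)

lemma root_le_in: "x \<preceq> y \<Longrightarrow> x \<in> T"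
  by (simp add: root_le_iff)

lemma root_le_refl [simp]: "x \<in> T \<Longrightarrow> x \<preceq> x"
  by (simp add: root_le_iff two_point)

lemma root_least: "x \<in> T \<Longrightarrow> \<rho> \<preceq> x"
  using two_point[of x \<rho>] sym12[of \<rho> x \<rho>] by (simp add: root_le_iff)

lemma root_le_antisym: "\<lbrakk>x \<preceq> y; y \<preceq> x\<rbrakk> \<Longrightarrow> x = y"
  using sym23[of \<rho> x y] by (auto simp: root_le_iff)

lemma root_le_trans: "\<lbrakk>x \<preceq> y; y \<preceq> z; z \<in> T\<rbrakk> \<Longrightarrow> x \<preceq> z"
  using interval_trans[of \<rho> x y z] by (simp add: root_le_iff)

lemma root_le_comparable:
  assumes "z \<preceq> x" "w \<preceq> x" "x \<in> T"
  shows "z \<preceq> w \<or> w \<preceq> z"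
proof -
  have T: "z \<in> T" "w \<in> T" "c \<rho> x z = z" "c \<rho> x w = w" using assms by (auto simp: root_le_iff)
  have "c \<rho> z w \<in> {c \<rho> z x, c \<rho> w x, c z w x}" "c \<rho> z x \<in> {c \<rho> z w, c \<rho> x w, c z x w}"
    using four_point[OF root T(1,2) assms(3)] four_point[OF root T(1) assms(3) T(2)] by simp_all
  then show ?thesis
    using T assms(3) sym23[of \<rho> z x] sym23[of \<rho> w x] sym23[of z x w] sym23[of \<rho> z w]
    by (cases "z = w") (auto simp: root_le_iff two_point)
qed

lemma meet_le1: "\<lbrakk>x \<in> T; y \<in> T\<rbrakk> \<Longrightarrow> meet x y \<preceq> x"
  by (simp add: root_le_iff three_point)

lemma meet_le2: "\<lbrakk>x \<in> T; y \<in> T\<rbrakk> \<Longrightarrow> meet x y \<preceq> y"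
  using meet_le1[of y x] sym23[of \<rho> x y] by simp

text \<open>Below \<open>x\<close> the points \<open>z\<close> and \<open>meet x y\<close> are
  comparable, so it remains to exclude that \<open>z\<close> is strictly the larger one; the
  four-point axiom does this.\<close>

lemma le_meet:
  assumes z: "z \<preceq> x" "z \<preceq> y" and xy: "x \<in> T" "y \<in> T"
  shows "z \<preceq> meet x y"
proof -
  define p where "p = meet x y"
  have p: "p \<in> T" "p \<preceq> x" "p \<preceq> y" using meet_le1 meet_le2 xy by (auto simp: p_def)
  have zT: "z \<in> T" using z root_le_in by blast
  have "z = p" if "p \<preceq> z"
  proof -
    have "p \<in> {c \<rho> x z, c \<rho> y z, c x y z}" unfolding p_def using four_point xy zT by simp
    then consider "z = p" | "c x y z = p" using z by (auto simp: root_le_iff)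
    then show ?thesis
    proof cases
      case 2
      have "c x z p = p" using three_point[of x z y] 2 sym23[of x z y] xy zT by simp
      moreover have "c \<rho> x z \<in> {c \<rho> x p, c \<rho> z p, c x z p}" using four_point xy zT p by simp
      ultimately show ?thesis using z p that by (auto simp: root_le_iff)
    qed
  qed
  then show ?thesis using root_le_comparable[OF z(1) p(2) xy(1)] p(1) unfolding p_def[symmetric] by auto
qed

lemma meet_eq_left: "\<lbrakk>x \<preceq> y; y \<in> T\<rbrakk> \<Longrightarrow> meet x y = x"
  using sym23[of \<rho> x y] by (simp add: root_le_iff)

text \<open>Translates intervals into the order from the root. Seen from \<open>x\<close>, the point
  \<open>e\<close> precedes \<open>m\<close>, which precedes \<open>\<rho>\<close>, so
  \<open>interval_trans\<close> and \<open>interval_suffix\<close> apply with root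
  \<open>x\<close>.\<close>

lemma root_le_interval:
  assumes "m \<preceq> x" "x \<in> T" "e \<in> T" "c x m e = e"
  shows "m \<preceq> e" "e \<preceq> x"
proof -
  have m: "m \<in> T" "c \<rho> x m = m" using assms by (auto simp: root_le_iff)
  have xm: "c x \<rho> m = m" using m assms(2) sym12[of x \<rho> m] by simp
  have "c x \<rho> e = e" using interval_trans[of x e m \<rho>] assms m xm by simp
  then show "e \<preceq> x" using assms sym12[of x \<rho> e] by (simp add: root_le_iff)
  have "c e \<rho> m = m" using interval_suffix[of x \<rho> m e] assms m xm by simp
  then show "m \<preceq> e" using assms m sym12[of e \<rho> m] by (simp add: root_le_iff)
qed

lemma branch_root: "\<lbrakk>x \<in> T; y \<in> T\<rbrakk> \<Longrightarrow> c x y \<rho> = meet x y"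
  using sym23[of x y \<rho>] sym12[of x \<rho> y] by simp

text \<open>By the four-point axiom with \<open>\<rho>\<close>, the branch point \<open>u\<close> is
  one of the three meets, hence comparable with \<open>p\<close>. If \<open>u \<preceq> p\<close>,
  then \<open>p\<close> lies between any two of \<open>x\<close>, \<open>y\<close>,
  \<open>u\<close>, and the axiom forces \<open>u = p\<close>.\<close>

lemma meet_le_branch:
  assumes "x \<in> T" "y \<in> T" "z \<in> T"
  shows "meet x y \<preceq> c x y z"
proof -
  define p where "p = meet x y"
  define u where "u = c x y z"
  have p: "p \<preceq> x" "p \<preceq> y" "p \<in> T" and u: "u \<in> T" "c x y u = u"
    using meet_le1 meet_le2 assms three_point by (auto simp: p_def u_def)
  have key: "u = p" if "u \<preceq> p"
  proof -
    have "c u x p = p" "c u y p = p"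
      using interval_suffix[of \<rho> x p u] interval_suffix[of \<rho> y p u] that p u assms
      by (auto simp: root_le_iff)
    then have "c x u p = p" "c y u p = p"
      using sym12[of u x p] sym12[of u y p] p u assms by simp_all
    moreover have "c x y p = p" using three_point[of x y \<rho>] assms p
      sym12[of x \<rho> y] sym23[of x y \<rho>] by (simp add: p_def)
    moreover have "c x y u \<in> {c x y p, c x u p, c y u p}"
      by (rule four_point) (use assms p u in auto)
    ultimately show ?thesis using u by auto
  qed
  have "u \<in> {c x y \<rho>, c x z \<rho>, c y z \<rho>}"
    unfolding u_def by (rule four_point) (use assms in auto)
  moreover have "c x y \<rho> = meet x y" "c x z \<rho> = meet x z" "c y z \<rho> = meet y z"
    using branch_root assms by auto
  ultimately consider "u = p" | "u = meet x z" | "u = meet y z" by (auto simp: p_def)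
  then have "p \<preceq> u"
  proof cases
    case 2
    then show ?thesis
      using root_le_comparable[of p x u] meet_le1[of x z] p assms key by auto
  next
    case 3
    then show ?thesis
      using root_le_comparable[of p y u] meet_le1[of y z] p assms key by auto
  qed (use p in simp)
  then show ?thesis by (simp add: p_def u_def)
qed

lemma branch_meets:
  assumes "x \<in> T" "y \<in> T" "z \<in> T"
  shows "c x y z \<in> {meet x y, meet x z, meet y z}"
    and "meet x y \<preceq> c x y z" "meet x z \<preceq> c x y z" "meet y z \<preceq> c x y z"
proof -
  have "c x y z \<in> {c x y \<rho>, c x z \<rho>, c y z \<rho>}"
    by (rule four_point) (use assms in auto)
  moreover have "c x y \<rho> = meet x y" "c x z \<rho> = meet x z" "c y z \<rho> = meet y z"
    using branch_root assms by auto
  ultimately show "c x y z \<in> {meet x y, meet x z, meet y z}" by simp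
  have "c x y z = c x z y" "c x y z = c y z x"
    using sym12[of x y z] sym23[of x y z] sym23[of y x z] assms by simp_all
  then show "meet x y \<preceq> c x y z" "meet x z \<preceq> c x y z" "meet y z \<preceq> c x y z"
    using meet_le_branch[OF assms] meet_le_branch[OF assms(1,3,2)] meet_le_branch[OF assms(2,3,1)] by simp_all
qed

end

text \<open>Common interface for the two height functions: one that may jump, for the embedding, and
  one without jumps, for its surjectivity. Density is order separability seen from the root, with
  the lower end \<open>m\<close> excluded.\<close>

locale tree_height = rooted_tree +
  fixes y :: "nat \<Rightarrow> 'a" and h :: "'a \<Rightarrow> real"
  assumes y_in [simp]: "y k \<in> T"
    and y_dense: "\<lbrakk>m \<preceq> x; x \<in> T; m \<noteq> x\<rbrakk> \<Longrightarrow> \<exists>k. y k \<preceq> x \<and> m \<preceq> y k \<and> y k \<noteq> m"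
    and h_nonneg: "x \<in> T \<Longrightarrow> 0 \<le> h x"
    and h_le_1: "x \<in> T \<Longrightarrow> h x \<le> 1"
    and h_strict: "\<lbrakk>m \<preceq> x; x \<in> T; m \<noteq> x\<rbrakk> \<Longrightarrow> h m < h x"
begin

lemma h_mono: "\<lbrakk>m \<preceq> x; x \<in> T\<rbrakk> \<Longrightarrow> h m \<le> h x"
  using h_strict by fastforce

text \<open>Since \<open>h\<close> increases strictly from the root, \<open>h (meet x x')\<close> plays the role of a Gromov product.\<close>

definition gromov :: "nat \<Rightarrow> nat \<Rightarrow> real" where
  "gromov k l = h (meet (y k) (y l))"

definition code :: "'a \<Rightarrow> nat \<Rightarrow> real" where
  "code x k = h (meet x (y k))"

lemma h_ultra:
  assumes "a \<in> T" "b \<in> T" "z \<in> T"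
  shows "min (h (meet a b)) (h (meet b z)) \<le> h (meet a z)"
proof -
  consider "meet a b \<preceq> meet b z" | "meet b z \<preceq> meet a b"
    using root_le_comparable[of "meet a b" b "meet b z"] meet_le1[of b z] meet_le2[of a b] assms by blast
  then have "meet a b \<preceq> meet a z \<or> meet b z \<preceq> meet a z"
  proof cases
    case 1
    then have "meet a b \<preceq> z" using root_le_trans meet_le2 assms by blast
    then show ?thesis using le_meet meet_le1 assms by blast
  next
    case 2
    then have "meet b z \<preceq> a" using root_le_trans meet_le1 assms by blast
    then show ?thesis using le_meet meet_le2 assms by blast
  qed
  then show ?thesis using h_mono[of _ "meet a z"] assms by (auto simp: min_le_iff_disj)
qed

sublocale gromov_matrix gromov
proof
  fix n m
  show "gromov n m = gromov m n" by (simp add: gromov_def sym23[of \<rho> "y n" "y m"])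
  show "0 \<le> gromov n m" "gromov n n \<le> 1" by (simp_all add: gromov_def h_nonneg h_le_1)
qed

lemma code_in_model:
  assumes x: "x \<in> T"
  shows "code x \<in> tree_model gromov"
  unfolding tree_model_def
proof (intro CollectI allI conjI)
  fix n m
  show "0 \<le> code x n" using x by (simp add: code_def h_nonneg)
  show "code x n \<le> gromov n n"
    using h_mono[OF meet_le2[OF x y_in[of n]]] by (simp add: code_def gromov_def two_point)
  show "min (code x n) (code x m) \<le> gromov n m"
    using h_ultra[of "y n" x "y m"] x by (simp add: code_def gromov_def sym23[of \<rho> x "y n"])
  show "min (code x n) (gromov n m) \<le> code x m"
    using h_ultra[of x "y n" "y m"] x by (simp add: code_def gromov_def)
qed

lemma code_mono:
  assumes "x \<preceq> x'" "x' \<in> T"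
  shows "code x \<le> code x'"
proof (rule le_funI)
  fix k
  have x: "x \<in> T" using assms root_le_in by blast
  have "meet x (y k) \<preceq> meet x' (y k)"
    using le_meet[OF root_le_trans[OF meet_le1 assms] meet_le2] x assms y_in by blast
  then show "code x k \<le> code x' k" using h_mono assms by (simp add: code_def)
qed

text \<open>A point \<open>y k\<close> above \<open>m = meet x x'\<close>, different from it and
  below \<open>x\<close>, separates: coordinate \<open>k\<close> is \<open>h (y k)\<close> at
  \<open>x\<close> but at most \<open>h m\<close> at \<open>x'\<close>.\<close>

lemma code_embedding:
  assumes le: "code x \<le> code x'" and x: "x \<in> T" "x' \<in> T"
  shows "x \<preceq> x'"
proof (rule ccontr)
  assume not: "\<not> x \<preceq> x'"
  define m where "m = meet x x'"
  have m: "m \<preceq> x" "m \<preceq> x'" "m \<in> T" using meet_le1 meet_le2 x by (auto simp: m_def)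
  then have "m \<noteq> x" using not by auto
  then obtain k where k: "y k \<preceq> x" "m \<preceq> y k" "y k \<noteq> m" using y_dense m x by blast
  have "meet x' (y k) \<preceq> m"
    unfolding m_def using le_meet[OF root_le_trans[OF meet_le2 k(1)] meet_le1] x y_in by blast
  then have "h (meet x' (y k)) \<le> h m" using h_mono m by blast
  also have "h m < h (y k)" using h_strict k by (metis y_in)
  also have "h (y k) = code x k"
    using k(1) x by (simp add: code_def root_le_iff)
  also have "code x k \<le> code x' k" using le by (simp add: le_fun_def)
  finally show False by (simp add: code_def)
qed

lemma inj_on_code: "inj_on code T"
  by (intro inj_onI) (metis code_embedding order_refl root_le_antisym)

lemma code_meet:
  assumes x: "x \<in> T" "x' \<in> T"
  shows "code (meet x x') = pmin (code x) (code x')"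
proof (rule antisym)
  show "code (meet x x') \<le> pmin (code x) (code x')"
    using code_mono meet_le1 meet_le2 x by (intro le_pmin) auto
  show "pmin (code x) (code x') \<le> code (meet x x')"
  proof (rule le_funI)
    fix k
    consider "meet x (y k) \<preceq> meet x' (y k)" | "meet x' (y k) \<preceq> meet x (y k)"
      using root_le_comparable[of "meet x (y k)" "y k" "meet x' (y k)"] meet_le2 x y_in by blast
    then show "pmin (code x) (code x') k \<le> code (meet x x') k"
    proof cases
      case 1
      have "meet x (y k) \<preceq> x'" by (rule root_le_trans[OF 1 meet_le1]) (simp_all add: x)
      then have "meet x (y k) \<preceq> meet (meet x x') (y k)"
        by (intro le_meet meet_le1 meet_le2) (simp_all add: x)
      then have "h (meet x (y k)) \<le> h (meet (meet x x') (y k))"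
        using h_mono x by simp
      then show ?thesis by (simp add: pmin_def code_def)
    next
      case 2
      have "meet x' (y k) \<preceq> x" by (rule root_le_trans[OF 2 meet_le1]) (simp_all add: x)
      then have "meet x' (y k) \<preceq> meet (meet x x') (y k)"
        by (intro le_meet meet_le1 meet_le2) (simp_all add: x)
      then have "h (meet x' (y k)) \<le> h (meet (meet x x') (y k))"
        using h_mono x by simp
      then show ?thesis by (simp add: pmin_def code_def)
    qed
  qed
qed

lemma code_branch:
  assumes x: "x1 \<in> T" "x2 \<in> T" "x3 \<in> T"
  shows "code (c x1 x2 x3) = pmedian (code x1) (code x2) (code x3)"
proof
  fix k
  let ?u = "c x1 x2 x3"
  have u: "?u \<in> T" using x by simp
  have "code ?u k \<in> {code (meet x1 x2) k, code (meet x1 x3) k, code (meet x2 x3) k}"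
    using branch_meets(1)[OF x] by auto
  moreover have "code (meet x1 x2) k \<le> code ?u k" "code (meet x1 x3) k \<le> code ?u k" "code (meet x2 x3) k \<le> code ?u k"
    using code_mono[OF branch_meets(2)[OF x] u] code_mono[OF branch_meets(3)[OF x] u]
      code_mono[OF branch_meets(4)[OF x] u] by (auto simp: le_fun_def)
  moreover have "pmedian (code x1) (code x2) (code x3) k
      = max (max (code (meet x1 x2) k) (code (meet x1 x3) k)) (code (meet x2 x3) k)"
    using x by (simp add: code_meet pmedian_def pmin_def)
  ultimately show "code ?u k = pmedian (code x1) (code x2) (code x3) k" by auto
qed

lemma metric_tree_map_code:
  "metric_tree_map T (\<lambda>x x'. dist (code x) (code x')) c"
  by (rule metric_tree_map_pullback[OF metric_tree_map_model inj_on_code _ nonempty])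
    (auto simp: code_in_model code_branch)

end

lemma (in metric_tree_map) compact_imp_mtotally_bounded:
  "compact_space mtopology \<Longrightarrow> mtotally_bounded M"
  by (simp add: compact_space_def compactin_imp_mtotally_bounded)

lemma (in rooted_tree) chain_supremum:
  assumes complete: "order_complete T c" and C: "C \<subseteq> T" "C \<noteq> {}"
    and chain: "Complete_Partial_Order.chain (tree_le T c \<rho>) C"
  shows "\<exists>s\<in>T. (\<forall>x\<in>C. x \<preceq> s) \<and> (\<forall>u\<in>T. (\<forall>x\<in>C. x \<preceq> u) \<longrightarrow> s \<preceq> u)"
proof -
  obtain s where "is_supremum T (tree_le T c \<rho>) C s"
    using complete[unfolded order_complete_def, rule_format, OF root, of C] C chain by auto
  then show ?thesis unfolding is_supremum_def by blast
qed

lemma (in rooted_tree) separable_enumeration: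
  assumes "order_separable T c"
  obtains y :: "nat \<Rightarrow> 'a" where "\<And>k. y k \<in> T"
    and "\<And>m x. \<lbrakk>m \<preceq> x; x \<in> T; m \<noteq> x\<rbrakk> \<Longrightarrow> \<exists>k. y k \<preceq> x \<and> m \<preceq> y k \<and> y k \<noteq> m"
proof -
  obtain D where D: "countable D" "D \<subseteq> T"
    "\<And>x y. \<lbrakk>x \<in> T; y \<in> T; x \<noteq> y\<rbrakk> \<Longrightarrow> D \<inter> (tree_interval T c x y - {y}) \<noteq> {}"
    using assms unfolding order_separable_def by meson
  \<comment> \<open>Adding the root guarantees a nonempty set to enumerate; \<open>D\<close> may be
    empty if \<open>T\<close> is a single point.\<close>
  define y where "y = from_nat_into (insert \<rho> D)"
  have ran: "range y = insert \<rho> D"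
    unfolding y_def using D(1) by (intro range_from_nat_into) auto
  show thesis
  proof
    have "insert \<rho> D \<subseteq> T" using D(2) by simp
    then show "y k \<in> T" for k using rangeI[of y k] unfolding ran by (rule subsetD)
    fix m x assume mx: "m \<preceq> x" "x \<in> T" "m \<noteq> x"
    then have "m \<in> T" using root_le_in by blast
    \<comment> \<open>The interval is taken from \<open>x\<close> to \<open>m\<close>, so that the
      excluded end is the lower one.\<close>
    then obtain d where d: "d \<in> D" "d \<in> T" "c x m d = d" "d \<noteq> m"
      using D(3)[of x m] mx by (auto simp: tree_interval_def)
    have "d \<preceq> x" "m \<preceq> d" using root_le_interval[OF mx(1,2) d(2,3)] by simp_all
    moreover obtain k where "y k = d" using ran d(1) by (metis insertCI rangeE)
    ultimately show "\<exists>k. y k \<preceq> x \<and> m \<preceq> y k \<and> y k \<noteq> m" using d(4) by blast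
  qed
qed

text \<open>A point \<open>y k\<close> above \<open>m\<close>, different from it and below
  \<open>x\<close>, is counted at \<open>x\<close> but not at \<open>m\<close>. This height may jump
  at the points \<open>y k\<close>.\<close>

lemma (in rooted_tree) tree_height_atomic:
  assumes y: "\<And>k. y k \<in> T"
    and dense: "\<And>m x. \<lbrakk>m \<preceq> x; x \<in> T; m \<noteq> x\<rbrakk> \<Longrightarrow> \<exists>k. y k \<preceq> x \<and> m \<preceq> y k \<and> y k \<noteq> m"
  shows "tree_height T c \<rho> y (\<lambda>x. wsum (\<lambda>k. of_bool (y k \<preceq> x)))"
proof
  fix m x assume mx: "m \<preceq> x" "x \<in> T" "m \<noteq> x"
  then obtain k where k: "y k \<preceq> x" "m \<preceq> y k" "y k \<noteq> m" using dense by blast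
  then have "\<not> y k \<preceq> m" using root_le_antisym by blast
  then show "wsum (\<lambda>k. of_bool (y k \<preceq> m)) < wsum (\<lambda>k. of_bool (y k \<preceq> x))"
    using k(1) root_le_trans[OF _ mx(1,2)] by (intro wsum_strict[where j = k]) auto
qed (use y dense in \<open>auto intro: wsum_bounds\<close>)

text \<open>Lets reals name points of the model, so that the extension fits into
  \<open>'a + real\<close>. A sequence is determined by the rationals below its members, hence by a
  set of naturals.\<close>

lemma inj_nat_real_real: "\<exists>j :: (nat \<Rightarrow> real) \<Rightarrow> real. inj j"
proof -
  obtain e :: "nat set \<Rightarrow> real" where e: "inj e"
    using nat_sets_eqpoll_reals unfolding eqpoll_def by (meson bij_betw_imp_inj_on)
  define S :: "(nat \<Rightarrow> real) \<Rightarrow> nat set"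
    where "S G = {to_nat (n, q) | n (q::rat). of_rat q < G n}" for G
  have mem: "to_nat (n, q) \<in> S G \<longleftrightarrow> of_rat q < G n" for n q G
    by (auto simp: S_def)
  have "inj S"
  proof (rule injI, rule ext, rule ccontr)
    fix G H n assume eq: "S G = S H" and ne: "G n \<noteq> H n"
    have "min (G n) (H n) < max (G n) (H n)" using ne by linarith
    then obtain q where "min (G n) (H n) < of_rat q" "of_rat q < max (G n) (H n)"
      using of_rat_dense by blast
    then show False using mem[of n q G] mem[of n q H] eq by (auto simp: min_def max_def split: if_splits)
  qed
  then show ?thesis using inj_compose[OF e] by blast
qed

section \<open>Extension, total boundedness and surjectivity of the embedding\<close>

context tree_height
begin

lemma sum_extension:
  "\<exists>(T' :: ('a + real) set) c'. algebraic_continuum_tree T' c' \<and> order_separable T' c' \<and>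
     subtree (Inl ` T) (transport_map Inl T c) T' c'"
proof -
  text \<open>The points of the model outside the image of \<open>T\<close> are named by reals.\<close>
  define X where "X = tree_model gromov"
  obtain j :: "(nat \<Rightarrow> real) \<Rightarrow> real" where j: "inj j" using inj_nat_real_real by blast
  define \<Phi> where "\<Phi> = case_sum code (inv j)"
  define T' :: "('a + real) set" where "T' = Inl ` T \<union> Inr ` j ` (X - code ` T)"
  have \<Phi>: "\<Phi> (Inl x) = code x" "\<Phi> (Inr (j G)) = G" for x G
    using j by (simp_all add: \<Phi>_def)
  have codeX: "code ` T \<subseteq> X" using code_in_model by (auto simp: X_def)
  have inj: "inj_on \<Phi> T'"
  proof (rule inj_onI)
    fix u v assume "u \<in> T'" "v \<in> T'" "\<Phi> u = \<Phi> v"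
    then show "u = v"
      using inj_on_code \<Phi> unfolding T'_def by (auto simp: inj_on_eq_iff)
  qed
  have img: "\<Phi> ` T' = X"
    using codeX by (force simp: T'_def image_Un image_image \<Phi>)
  have bij: "bij_betw \<Phi> T' X" using inj img by (simp add: bij_betw_def)
  define c' where "c' u v w = inv_into T' \<Phi> (pmedian (\<Phi> u) (\<Phi> v) (\<Phi> w))" for u v w
  define r where "r = (\<lambda>u v. dist (\<Phi> u) (\<Phi> v))"
  have c': "c' u v w \<in> T'" "\<Phi> (c' u v w) = pmedian (\<Phi> u) (\<Phi> v) (\<Phi> w)"
    if "u \<in> T'" "v \<in> T'" "w \<in> T'" for u v w
  proof -
    have "\<Phi> u \<in> X" "\<Phi> v \<in> X" "\<Phi> w \<in> X" using img that by auto
    then have med: "pmedian (\<Phi> u) (\<Phi> v) (\<Phi> w) \<in> \<Phi> ` T'"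
      using pmedian_in_model img unfolding X_def by simp
    show "c' u v w \<in> T'" using inv_into_into[OF med] by (simp only: c'_def)
    show "\<Phi> (c' u v w) = pmedian (\<Phi> u) (\<Phi> v) (\<Phi> w)"
      using f_inv_into_f[OF med] by (simp only: c'_def)
  qed
  have ne: "T' \<noteq> {}" using nonempty by (auto simp: T'_def)
  interpret X: metric_tree_map X dist pmedian unfolding X_def by (rule metric_tree_map_model)
  interpret T': metric_tree_map T' r c'
    unfolding r_def
    by (rule metric_tree_map_pullback[where f = \<Phi> and c' = c', OF X.metric_tree_map_axioms inj _ ne])
      (simp_all add: img c')
  note top = mtopology_pullback[where f = \<Phi>, OF X.Metric_space_axioms T'.Metric_space_axioms[unfolded r_def] bij, folded r_def]
  have comp: "compact_space T'.mtopology" and conn: "connected_space T'.mtopology"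
    using top compact_model connected_model unfolding X_def by blast+
  have sub: "subtree (Inl ` T) (transport_map Inl T c) T' c'"
  proof -
    have eq: "c' (Inl x1) (Inl x2) (Inl x3) = Inl (c x1 x2 x3)" if x: "x1 \<in> T" "x2 \<in> T" "x3 \<in> T" for x1 x2 x3
    proof -
      have T: "Inl x1 \<in> T'" "Inl x2 \<in> T'" "Inl x3 \<in> T'" "Inl (c x1 x2 x3) \<in> T'" using x by (auto simp: T'_def)
      have "\<Phi> (c' (Inl x1) (Inl x2) (Inl x3)) = \<Phi> (Inl (c x1 x2 x3))"
        using c'(2)[OF T(1-3)] x by (simp add: \<Phi> code_branch)
      then show ?thesis using inj_onD[OF inj _ c'(1)[OF T(1-3)] T(4)] by simp
    qed
    have "Inl ` T \<subseteq> T'" by (auto simp: T'_def)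
    then show ?thesis
      unfolding subtree_def transport_map_def by (auto simp: eq inv_into_f_f)
  qed
  show ?thesis
    using T'.algebraic_continuum_tree[OF conn comp] T'.order_separable[OF T'.compact_imp_mtotally_bounded[OF comp]]
      sub by blast
qed

lemma totally_bounded_metric:
  "\<exists>r. metric_tree_map T r c \<and> Metric_space.mtotally_bounded T r T"
proof -
  interpret X: metric_tree_map "tree_model gromov" dist pmedian by (rule metric_tree_map_model)
  interpret T': metric_tree_map T "\<lambda>x x'. dist (code x) (code x')" c by (rule metric_tree_map_code)
  have "X.mtotally_bounded (tree_model gromov)"
    by (rule X.compact_imp_mtotally_bounded[OF compact_model])
  then have "T'.mtotally_bounded T"
    by (intro mtotally_bounded_pullback[where f = code, OF X.Metric_space_axioms T'.Metric_space_axioms])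
      (auto simp: code_in_model)
  then show ?thesis using T'.metric_tree_map_axioms by blast
qed

text \<open>The preimage of \<open>G\<close> is the supremum \<open>s\<close> of the points with
  code at most \<open>G\<close>. These form a chain because their codes lie below the common model
  point \<open>G\<close>.\<close>

lemma code_surj:
  assumes complete: "order_complete T c"
    and ivt: "\<And>x t. \<lbrakk>x \<in> T; 0 \<le> t; t \<le> h x\<rbrakk> \<Longrightarrow> \<exists>e. e \<preceq> x \<and> h e = t"
  shows "code ` T = tree_model gromov"
proof
  show "code ` T \<subseteq> tree_model gromov" using code_in_model by auto
  show "tree_model gromov \<subseteq> code ` T"
  proof
    fix G assume G: "G \<in> tree_model gromov"
    define C where "C = {x \<in> T. code x \<le> G}"
    \<comment> \<open>A point of height 0 below the root can only be the root, so the code of the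
      root is the zero sequence.\<close>
    obtain e where "e \<preceq> \<rho>" "h e = 0" using ivt[of \<rho> 0] h_nonneg by auto
    then have "h \<rho> = 0" using root_le_antisym root_least root_le_in by metis
    then have "code \<rho> = (\<lambda>k. 0)"
      using meet_eq_left[OF root_least] by (auto simp: code_def)
    then have "\<rho> \<in> C" using tree_modelD(1)[OF G] by (simp add: C_def le_fun_def)
    have chain: "Complete_Partial_Order.chain (tree_le T c \<rho>) C"
    proof (rule chainI)
      fix x x' assume x: "x \<in> C" "x' \<in> C"
      then have "code x \<le> code x' \<or> code x' \<le> code x"
        using model_chain[OF _ _ G] code_in_model by (simp add: C_def)
      then show "x \<preceq> x' \<or> x' \<preceq> x" using code_embedding x by (auto simp: C_def)
    qed
    have C: "C \<subseteq> T" "C \<noteq> {}" using \<open>\<rho> \<in> C\<close> unfolding C_def by blast+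
    obtain s where s: "s \<in> T" "\<And>x. x \<in> C \<Longrightarrow> x \<preceq> s"
      "\<And>u. u \<in> T \<Longrightarrow> \<forall>x\<in>C. x \<preceq> u \<Longrightarrow> s \<preceq> u"
      using chain_supremum[OF complete C chain] by blast
    have "code s n = G n" for n
    proof (rule antisym; rule ccontr)
      have m: "meet s (y n) \<in> T" "meet s (y n) \<preceq> s" "meet s (y n) \<preceq> y n"
        using s(1) meet_le1 meet_le2 by simp_all
      assume "\<not> code s n \<le> G n"
      \<comment> \<open>A point \<open>e\<close> of height \<open>t\<close> below \<open>s\<close>
        and \<open>y n\<close> is no upper bound of \<open>C\<close>, so some \<open>x\<close> in
        \<open>C\<close> lies above it; then \<open>t \<le> code x n\<close>, contrary to
        \<open>code x \<le> G\<close>.\<close>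
      then obtain t where t: "G n < t" "t < code s n" using dense not_le by blast
      moreover have "0 \<le> G n" using tree_modelD(1)[OF G] .
      ultimately obtain e where e: "e \<preceq> meet s (y n)" "h e = t"
        using ivt[OF m(1), of t] by (auto simp: code_def)
      have es: "e \<preceq> s" "e \<preceq> y n" "e \<in> T"
        using root_le_trans[OF e(1)] m s(1) e(1) root_le_in by auto
      have "\<exists>x\<in>C. \<not> x \<preceq> e"
      proof (rule ccontr)
        assume "\<not> ?thesis"
        then have "s \<preceq> e" using s(3) es(3) by blast
        then have "s = e" using es(1) root_le_antisym by blast
        then have "s \<preceq> meet s (y n)" using e by simp
        then have "h s \<le> code s n" "code s n \<le> h s"
          using h_mono m s(1) by (auto simp: code_def)
        then show False using \<open>s = e\<close> e(2) t(2) by simp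
      qed
      then obtain x where x: "x \<in> C" "\<not> x \<preceq> e" by blast
      then have "e \<preceq> x" using root_le_comparable[OF s(2)[OF x(1)] es(1) s(1)] by blast
      then have "e \<preceq> meet x (y n)" using le_meet es(2) x(1) by (simp add: C_def)
      then have "h e \<le> code x n" using h_mono x(1) by (simp add: C_def code_def)
      also have "\<dots> \<le> G n" using x(1) by (simp add: C_def le_fun_def)
      finally show False using e(2) t(1) by simp
    next
      assume "\<not> G n \<le> code s n"
      \<comment> \<open>A point \<open>e\<close> of height \<open>t\<close> below \<open>y n\<close>
        has code at most \<open>G\<close>, by the model condition
        \<open>min (G n) (gromov n k) \<le> G k\<close>. So \<open>e\<close> is in \<open>C\<close>
        and below \<open>s\<close>, which gives \<open>t \<le> code s n\<close>.\<close>
      then obtain t where t: "code s n < t" "t < G n" using dense not_le by blast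
      have "0 \<le> t" using t(1) h_nonneg[of "meet s (y n)"] s(1) by (simp add: code_def)
      moreover have "t \<le> h (y n)"
        using t(2) tree_modelD(2)[OF G, of n] by (simp add: gromov_def two_point)
      ultimately obtain e where e: "e \<preceq> y n" "h e = t" using ivt[of "y n" t] by auto
      have eT: "e \<in> T" using e(1) root_le_in by blast
      have "code e k \<le> G k" for k
      proof -
        have "code e k \<le> h e" using h_mono[OF meet_le1] eT by (simp add: code_def)
        moreover have "code e k \<le> gromov n k"
          using code_mono[OF e(1)] by (simp add: le_fun_def code_def gromov_def)
        ultimately show ?thesis using tree_modelD(4)[OF G, of n k] e(2) t(2) by linarith
      qed
      then have "e \<preceq> s" using s(2) eT by (simp add: C_def le_fun_def)
      then have "e \<preceq> meet s (y n)" using le_meet e(1) s(1) by simp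
      then have "h e \<le> code s n" using h_mono s(1) by (simp add: code_def)
      then show False using e(2) t(1) by simp
    qed
    then have "code s = G" by blast
    then show "G \<in> code ` T" using s(1) by blast
  qed
qed

lemma compact_connected_metric:
  assumes "order_complete T c"
    and "\<And>x t. \<lbrakk>x \<in> T; 0 \<le> t; t \<le> h x\<rbrakk> \<Longrightarrow> \<exists>e. e \<preceq> x \<and> h e = t"
  shows "\<exists>r. metric_tree_map T r c \<and> compact_space (Metric_space.mtopology T r)
    \<and> connected_space (Metric_space.mtopology T r)"
proof -
  interpret X: metric_tree_map "tree_model gromov" dist pmedian by (rule metric_tree_map_model)
  interpret T': metric_tree_map T "\<lambda>x x'. dist (code x) (code x')" c by (rule metric_tree_map_code)
  have "bij_betw code T (tree_model gromov)"
    using code_surj[OF assms] inj_on_code by (simp add: bij_betw_def)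
  note top = mtopology_pullback[where f = code, OF X.Metric_space_axioms T'.Metric_space_axioms this]
  show ?thesis
    using T'.metric_tree_map_axioms top(1)[OF compact_model] top(2)[OF connected_model] by blast
qed

end

section \<open>Height functions without jumps\<close>

text \<open>The gap condition excludes jumps along segments from the root without asking that every
  value be attained; order completeness will supply attained values for the weighted sum.\<close>

locale separating_family = rooted_tree +
  fixes F :: "nat \<Rightarrow> 'a \<Rightarrow> real"
  assumes F_nonneg: "x \<in> T \<Longrightarrow> 0 \<le> F k x"
    and F_le_1: "x \<in> T \<Longrightarrow> F k x \<le> 1"
    and F_root: "F k \<rho> = 0"
    and F_mono: "\<lbrakk>x \<preceq> x'; x' \<in> T\<rbrakk> \<Longrightarrow> F k x \<le> F k x'"
    and F_gap: "\<lbrakk>x \<preceq> x'; x' \<in> T; F k x < \<alpha>; \<alpha> < \<beta>; \<beta> < F k x'\<rbrakk> \<Longrightarrow>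
      \<exists>e. x \<preceq> e \<and> e \<preceq> x' \<and> \<alpha> < F k e \<and> F k e < \<beta>"
    and F_separating: "\<lbrakk>x \<preceq> x'; x' \<in> T; x \<noteq> x'\<rbrakk> \<Longrightarrow> \<exists>k. F k x < F k x'"
begin

definition weight :: "'a \<Rightarrow> real" where "weight x = wsum (\<lambda>k. F k x)"

lemma weight_bounds: "x \<in> T \<Longrightarrow> 0 \<le> weight x" "x \<in> T \<Longrightarrow> weight x \<le> 1"
  unfolding weight_def by (auto intro: wsum_bounds F_nonneg F_le_1)

lemma weight_strict:
  assumes "x \<preceq> x'" "x' \<in> T" "x \<noteq> x'"
  shows "weight x < weight x'"
proof -
  obtain k where "F k x < F k x'" using F_separating assms by blast
  then show ?thesis unfolding weight_def
    using assms root_le_in F_nonneg F_le_1 F_mono by (intro wsum_strict) auto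
qed

text \<open>Finitely many functions are treated at once because points below \<open>s\<close> are
  comparable: the higher of two approximants serves for both.\<close>

lemma left_approximation:
  assumes s: "s \<in> T" "s \<noteq> \<rho>" and "\<epsilon> > 0"
  shows "\<exists>z. z \<preceq> s \<and> z \<noteq> s \<and> (\<forall>k<N. F k s - \<epsilon> \<le> F k z)"
proof (induction N)
  case 0
  then show ?case using root_least s by auto
next
  case (Suc N)
  then obtain z where z: "z \<preceq> s" "z \<noteq> s" "\<forall>k<N. F k s - \<epsilon> \<le> F k z" by blast
  obtain w where w: "w \<preceq> s" "w \<noteq> s" "F N s - \<epsilon> \<le> F N w"
  proof (cases "F N s - \<epsilon> \<le> F N \<rho>")
    case True
    then show thesis using that[of \<rho>] root_least s by auto
  next
    case False
    \<comment> \<open>The upper bound \<open>F N s - \<epsilon> / 2\<close> keeps \<open>e\<close>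
      different from \<open>s\<close>.\<close>
    then obtain e where "e \<preceq> s" "F N s - \<epsilon> < F N e" "F N e < F N s - \<epsilon> / 2"
      using F_gap[of \<rho> s N "F N s - \<epsilon>" "F N s - \<epsilon> / 2"] root_least s \<open>\<epsilon> > 0\<close> by auto
    then show thesis using that[of e] \<open>\<epsilon> > 0\<close> by (cases "e = s") auto
  qed
  have T: "z \<in> T" "w \<in> T" using z w root_le_in by blast+
  from root_le_comparable[OF z(1) w(1) s(1)] show ?case
  proof
    assume le: "z \<preceq> w"
    have "F k s - \<epsilon> \<le> F k w" if "k < Suc N" for k
    proof (cases "k = N")
      case False
      then have "F k s - \<epsilon> \<le> F k z" using z(3) that by simp
      then show ?thesis using F_mono[OF le T(2), of k] by linarith
    qed (use w in simp)
    then show ?thesis using w by blast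
  next
    assume le: "w \<preceq> z"
    have "F k s - \<epsilon> \<le> F k z" if "k < Suc N" for k
    proof (cases "k = N")
      case True
      then show ?thesis using F_mono[OF le T(1), of N] w(3) by simp
    qed (use z that in simp)
    then show ?thesis using z by blast
  qed
qed

lemma right_approximation:
  assumes s: "s \<preceq> x" "s \<noteq> x" "x \<in> T" and "\<epsilon> > 0"
  shows "\<exists>z. s \<preceq> z \<and> z \<preceq> x \<and> z \<noteq> s \<and> (\<forall>k<N. F k z \<le> F k s + \<epsilon>)"
proof (induction N)
  case 0
  then show ?case using s by auto
next
  case (Suc N)
  then obtain z where z: "s \<preceq> z" "z \<preceq> x" "z \<noteq> s" "\<forall>k<N. F k z \<le> F k s + \<epsilon>" by blast
  obtain w where w: "s \<preceq> w" "w \<preceq> x" "w \<noteq> s" "F N w \<le> F N s + \<epsilon>"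
  proof (cases "F N x \<le> F N s + \<epsilon>")
    case True
    then show thesis using that[of x] s by auto
  next
    case False
    then obtain e where "s \<preceq> e" "e \<preceq> x" "F N s + \<epsilon> / 2 < F N e" "F N e < F N s + \<epsilon>"
      using F_gap[of s x N "F N s + \<epsilon> / 2" "F N s + \<epsilon>"] s \<open>\<epsilon> > 0\<close> by auto
    then show thesis using that[of e] \<open>\<epsilon> > 0\<close> by (cases "e = s") auto
  qed
  have T: "z \<in> T" "w \<in> T" using z w root_le_in by blast+
  from root_le_comparable[OF z(2) w(2) s(3)] show ?case
  proof
    assume le: "z \<preceq> w"
    have "F k z \<le> F k s + \<epsilon>" if "k < Suc N" for k
    proof (cases "k = N")
      case True
      then show ?thesis using F_mono[OF le T(2), of N] w(4) by simp
    qed (use z that in simp)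
    then show ?thesis using z by blast
  next
    assume le: "w \<preceq> z"
    have "F k w \<le> F k s + \<epsilon>" if "k < Suc N" for k
    proof (cases "k = N")
      case False
      then have "F k z \<le> F k s + \<epsilon>" using z(4) that by simp
      then show ?thesis using F_mono[OF le T(1), of k] by linarith
    qed (use w in simp)
    then show ?thesis using w by blast
  qed
qed

lemma weight_close:
  assumes "x \<preceq> x'" "x' \<in> T" "0 \<le> \<epsilon>" "\<forall>k<N. F k x' \<le> F k x + \<epsilon>"
  shows "weight x' \<le> weight x + (\<epsilon> + (1/2)^N)"
proof -
  have x: "x \<in> T" using assms root_le_in by blast
  have "\<bar>wsum (\<lambda>k. F k x') - wsum (\<lambda>k. F k x)\<bar> \<le> \<epsilon> + (1/2)^N"
  proof (rule wsum_close)
    show "\<bar>F k x' - F k x\<bar> \<le> \<epsilon>" if "k < N" for k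
      using F_mono[OF assms(1,2), of k] assms(4) that by fastforce
  qed (use x assms F_nonneg F_le_1 in auto)
  then show ?thesis by (simp add: weight_def)
qed

text \<open>The value is attained at the supremum of the points below \<open>x\<close> of weight at
  most \<open>t\<close>: approximation from the left excludes a larger weight there, approximation
  from the right a smaller one.\<close>

lemma weight_ivt:
  assumes complete: "order_complete T c" and x: "x \<in> T" and t: "0 \<le> t" "t \<le> weight x"
  shows "\<exists>e. e \<preceq> x \<and> weight e = t"
proof -
  define C where "C = {z. z \<preceq> x \<and> weight z \<le> t}"
  have "weight \<rho> = 0" by (simp add: weight_def F_root wsum_def)
  then have "\<rho> \<in> C" using root_least x t by (simp add: C_def)
  have chain: "Complete_Partial_Order.chain (tree_le T c \<rho>) C"
    using root_le_comparable x by (intro chainI) (auto simp: C_def)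
  have C: "C \<subseteq> T" "C \<noteq> {}" using root_le_in \<open>\<rho> \<in> C\<close> unfolding C_def by blast+
  obtain s where s: "s \<in> T" "\<And>x. x \<in> C \<Longrightarrow> x \<preceq> s"
    "\<And>u. u \<in> T \<Longrightarrow> \<forall>x\<in>C. x \<preceq> u \<Longrightarrow> s \<preceq> u"
    using chain_supremum[OF complete C chain] by blast
  have sx: "s \<preceq> x" using s(3)[OF x] by (simp add: C_def)
  have small: "\<exists>N. (1/2::real)^N < \<delta>" if "\<delta> > 0" for \<delta>
    using real_arch_pow_inv[OF that, of "1/2"] by simp
  have "weight s = t"
  proof (rule antisym; rule ccontr)
    assume "\<not> weight s \<le> t"
    then have gap: "(weight s - t) / 2 > 0" and "s \<noteq> \<rho>" using \<open>weight \<rho> = 0\<close> t by auto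
    \<comment> \<open>Half of the excess is spent on the first \<open>N\<close> functions, the other
      half on the tail of the sum.\<close>
    obtain N where N: "(1/2::real)^N < (weight s - t) / 2" using small[OF gap] by blast
    obtain z where z: "z \<preceq> s" "z \<noteq> s" "\<forall>k<N. F k s - (weight s - t) / 2 \<le> F k z"
      using left_approximation[OF s(1) \<open>s \<noteq> \<rho>\<close> gap] by blast
    have zT: "z \<in> T" using z root_le_in by blast
    have "\<not> s \<preceq> z" using z root_le_antisym by blast
    then obtain w where w: "w \<in> C" "\<not> w \<preceq> z" using s(3)[OF zT] by blast
    then have "z \<preceq> w" using root_le_comparable[OF z(1) s(2)[OF w(1)] s(1)] by blast
    moreover have "w \<in> T" "weight w \<le> t" using w root_le_in by (auto simp: C_def)
    ultimately have "weight z \<le> t" using weight_strict[of z w] by fastforce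
    moreover have "\<forall>k<N. F k s \<le> F k z + (weight s - t) / 2" using z(3) by (simp add: algebra_simps)
    then have "weight s \<le> weight z + ((weight s - t) / 2 + (1/2)^N)"
      using weight_close[OF z(1) s(1)] gap by (meson less_imp_le)
    ultimately show False using N by argo
  next
    assume "\<not> t \<le> weight s"
    then have gap: "(t - weight s) / 2 > 0" and "s \<noteq> x" using t by auto
    obtain N where N: "(1/2::real)^N < (t - weight s) / 2" using small[OF gap] by blast
    obtain z where z: "s \<preceq> z" "z \<preceq> x" "z \<noteq> s" "\<forall>k<N. F k z \<le> F k s + (t - weight s) / 2"
      using right_approximation[OF sx \<open>s \<noteq> x\<close> x gap] by blast
    have zT: "z \<in> T" using z root_le_in by blast
    have "weight z \<le> weight s + ((t - weight s) / 2 + (1/2)^N)"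
      using weight_close[OF z(1) zT _ z(4)] gap by simp
    then have "weight z \<le> t" using N by argo
    then have "z \<preceq> s" using s(2) z(2) by (simp add: C_def)
    then show False using z root_le_antisym by blast
  qed
  then show ?thesis using sx by blast
qed

end

section \<open>Dyadic chains and their ramp functions\<close>

context rooted_tree
begin

definition mid :: "'a \<Rightarrow> 'a \<Rightarrow> 'a" where
  "mid a b = (SOME e. a \<preceq> e \<and> e \<preceq> b \<and> e \<noteq> a \<and> e \<noteq> b)"

text \<open>Index \<open>k\<close> at level \<open>n\<close> stands for the parameter
  \<open>k / 2^n\<close>, and even indices repeat the previous level. Only
  \<open>k \<le> 2^n\<close> is meaningful.\<close>

fun dyadic :: "'a \<Rightarrow> 'a \<Rightarrow> nat \<Rightarrow> nat \<Rightarrow> 'a" where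
  "dyadic a b 0 k = (if k = 0 then a else b)"
| "dyadic a b (Suc n) k = (if even k then dyadic a b n (k div 2)
     else mid (dyadic a b n (k div 2)) (dyadic a b n (k div 2 + 1)))"

text \<open>When \<open>a \<preceq> b\<close>, the dyadic points form a chain from \<open>a\<close> to \<open>b\<close> indexed by the dyadic rationals of
  \<open>[0,1]\<close>, and the ramp reads off how much of this chain lies below \<open>x\<close>. It attains every dyadic
  value on the chain, which excludes jumps. Inserting \<open>0\<close> covers the points that are not above \<open>a\<close>.\<close>

definition ramp :: "'a \<Rightarrow> 'a \<Rightarrow> 'a \<Rightarrow> real" where
  "ramp a b x = Sup (insert 0 {real k / 2^n | n k. k \<le> 2^n \<and> dyadic a b n k \<preceq> x})"

lemma mid:
  assumes edges: "tree_edges T c = {}" and ab: "a \<preceq> b" "b \<in> T" "a \<noteq> b"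
  shows "a \<preceq> mid a b" "mid a b \<preceq> b" "mid a b \<noteq> a" "mid a b \<noteq> b"
proof -
  have a: "a \<in> T" using ab root_le_in by blast
  have "tree_interval T c a b \<noteq> {a, b}"
    using edges ab a unfolding tree_edges_def by blast
  moreover have "a \<in> tree_interval T c a b" "b \<in> tree_interval T c a b"
    using a ab two_point[of b a] sym23[of a b a] sym12[of a a b] two_point[of a b] sym12[of a b a]
    by (auto simp: tree_interval_def)
  ultimately obtain e where e: "e \<in> T" "c a b e = e" "e \<noteq> a" "e \<noteq> b"
    unfolding tree_interval_def by blast
  then have "c b a e = e" using sym12[of a b e] a ab by simp
  then have "a \<preceq> e \<and> e \<preceq> b \<and> e \<noteq> a \<and> e \<noteq> b" using root_le_interval[OF ab(1,2) e(1)] e by simp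
  then have "a \<preceq> mid a b \<and> mid a b \<preceq> b \<and> mid a b \<noteq> a \<and> mid a b \<noteq> b" unfolding mid_def by (rule someI)
  then show "a \<preceq> mid a b" "mid a b \<preceq> b" "mid a b \<noteq> a" "mid a b \<noteq> b" by simp_all
qed

lemma ramp_le_1: "ramp a b x \<le> 1"
  unfolding ramp_def by (rule cSup_least) (auto simp: divide_le_eq_1 simp flip: of_nat_power)

lemma ramp_upper:
  assumes "k \<le> 2^n" "dyadic a b n k \<preceq> x"
  shows "real k / 2^n \<le> ramp a b x"
  unfolding ramp_def
proof (rule cSup_upper)
  show "bdd_above (insert 0 {real k / 2^n | n k. k \<le> 2^n \<and> dyadic a b n k \<preceq> x})"
    by (rule bdd_aboveI[of _ 1]) (auto simp: divide_le_eq_1 simp flip: of_nat_power)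
qed (use assms in blast)

lemma ramp_nonneg: "0 \<le> ramp a b x"
  unfolding ramp_def
proof (rule cSup_upper)
  show "bdd_above (insert 0 {real k / 2^n | n k. k \<le> 2^n \<and> dyadic a b n k \<preceq> x})"
    by (rule bdd_aboveI[of _ 1]) (auto simp: divide_le_eq_1 simp flip: of_nat_power)
qed simp

lemma ramp_least:
  assumes "0 \<le> u" "\<And>n k. \<lbrakk>k \<le> 2^n; dyadic a b n k \<preceq> x\<rbrakk> \<Longrightarrow> real k / 2^n \<le> u"
  shows "ramp a b x \<le> u"
  unfolding ramp_def by (rule cSup_least) (use assms in auto)

lemma ramp_greater:
  assumes "0 \<le> u" "u < ramp a b x"
  obtains n k where "k \<le> 2^n" "dyadic a b n k \<preceq> x" "u < real k / 2^n"
  using ramp_least[OF assms(1), of a b x] assms(2) by (meson not_le)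

lemma ramp_mono:
  assumes "x \<preceq> x'" "x' \<in> T"
  shows "ramp a b x \<le> ramp a b x'"
  by (rule ramp_least) (use ramp_nonneg ramp_upper root_le_trans assms in blast)+

lemma dyadic_density:
  assumes "0 \<le> \<alpha>" "\<alpha> < \<beta>" "\<beta> \<le> (1::real)"
  obtains n k where "k \<le> 2^n" "\<alpha> < real k / 2^n" "real k / 2^n < \<beta>"
proof -
  obtain n where n: "(1/2::real)^n < \<beta> - \<alpha>"
    using real_arch_pow_inv[of "\<beta> - \<alpha>" "1/2"] assms by auto
  define k where "k = nat \<lfloor>\<alpha> * 2^n\<rfloor> + 1"
  have "real k = of_int \<lfloor>\<alpha> * 2^n\<rfloor> + 1" using assms by (simp add: k_def)
  then have k: "\<alpha> * 2^n < real k" "real k \<le> \<alpha> * 2^n + 1" by linarith+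
  then have "\<alpha> < real k / 2^n" by (simp add: field_simps)
  moreover have "real k / 2^n \<le> \<alpha> + (1/2)^n"
    using k(2) by (simp add: field_simps power_divide)
  then have lt: "real k / 2^n < \<beta>" using n by linarith
  moreover have "k \<le> 2^n"
  proof -
    have "real k < \<beta> * 2^n" using lt by (simp add: field_simps)
    also have "\<dots> \<le> 1 * 2^n" using assms(3) by (intro mult_right_mono) auto
    finally have "real k < real (2^n)" by simp
    then show ?thesis by linarith
  qed
  ultimately show thesis using that by blast
qed

context
  fixes a b
  assumes edges: "tree_edges T c = {}" and ab: "a \<preceq> b" "b \<in> T" "a \<noteq> b"
begin

text \<open>Distinctness and membership are carried through the induction because \<open>mid\<close>
  needs distinct comparable neighbours.\<close>

lemma dyadic_step:
  "k < 2^n \<Longrightarrow> dyadic a b n k \<preceq> dyadic a b n (Suc k) \<and> dyadic a b n k \<noteq> dyadic a b n (Suc k)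
     \<and> dyadic a b n (Suc k) \<in> T"
proof (induction n arbitrary: k)
  case 0
  then show ?case using ab by simp
next
  case (Suc n)
  define l where "l = k div 2"
  have l: "l < 2^n" using Suc.prems by (simp add: l_def)
  note IH = Suc.IH[OF l]
  note m = mid[OF edges conjunct1[OF IH] conjunct2[OF conjunct2[OF IH]] conjunct1[OF conjunct2[OF IH]]]
  show ?case
  proof (cases "even k")
    case True
    then have "Suc k div 2 = l" "odd (Suc k)" by (simp_all add: l_def)
    then show ?thesis using m True root_le_in[OF m(2)] by (simp add: l_def[symmetric])
  next
    case False
    then have "Suc k div 2 = Suc l" "even (Suc k)" by (simp_all add: l_def)
    then show ?thesis using m False IH by (simp add: l_def[symmetric])
  qed
qed

lemma dyadic_mem: "k \<le> 2^n \<Longrightarrow> dyadic a b n k \<in> T"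
  using dyadic_step[of k n] dyadic_step[of "k - 1" n] root_le_in
  by (cases k) (auto simp: Suc_le_eq)

lemma dyadic_mono:
  assumes "k \<le> l" "l \<le> 2^n"
  shows "dyadic a b n k \<preceq> dyadic a b n l"
  using assms
proof (induction l rule: dec_induct)
  case base
  then show ?case using dyadic_mem by simp
next
  case (step l)
  then have "dyadic a b n k \<preceq> dyadic a b n l" "dyadic a b n l \<preceq> dyadic a b n (Suc l)" "dyadic a b n (Suc l) \<in> T"
    using dyadic_step[of l n] by auto
  then show ?case by (rule root_le_trans)
qed

lemma dyadic_strict:
  assumes "k < l" "l \<le> 2^n"
  shows "\<not> dyadic a b n l \<preceq> dyadic a b n k"
proof
  assume "dyadic a b n l \<preceq> dyadic a b n k"
  moreover have "dyadic a b n (Suc k) \<preceq> dyadic a b n l" using dyadic_mono[of "Suc k" l n] assms by simp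
  moreover have "dyadic a b n k \<in> T" using dyadic_mem assms by simp
  ultimately have "dyadic a b n (Suc k) \<preceq> dyadic a b n k" using root_le_trans by blast
  then show False using dyadic_step[of k n] assms root_le_antisym by auto
qed

lemma dyadic_refine: "dyadic a b (n + m) (k * 2^m) = dyadic a b n k"
  by (induction m) simp_all

lemma dyadic_cross:
  assumes "real k / 2^n < real l / 2^m" "l \<le> 2^m"
  shows "dyadic a b n k \<preceq> dyadic a b m l" "\<not> dyadic a b m l \<preceq> dyadic a b n k"
proof -
  have "real k * 2^m < real l * 2^n" using assms(1) by (simp add: field_simps)
  then have "real (k * 2^m) < real (l * 2^n)" by simp
  then have lt: "k * 2^m < l * 2^n" by (simp only: of_nat_less_iff)
  have le: "l * 2^n \<le> 2^(n + m)" using assms(2) by (simp add: power_add mult.commute)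
  have eq: "dyadic a b (n + m) (k * 2^m) = dyadic a b n k" "dyadic a b (n + m) (l * 2^n) = dyadic a b m l"
    using dyadic_refine[of n m k] dyadic_refine[of m n l] by (simp_all add: add.commute)
  show "dyadic a b n k \<preceq> dyadic a b m l" using dyadic_mono[OF less_imp_le[OF lt] le] eq by simp
  show "\<not> dyadic a b m l \<preceq> dyadic a b n k" using dyadic_strict[OF lt le] eq by simp
qed

lemma ramp_dyadic:
  assumes k: "k \<le> 2^n"
  shows "ramp a b (dyadic a b n k) = real k / 2^n"
proof (rule antisym)
  show "ramp a b (dyadic a b n k) \<le> real k / 2^n"
    by (rule ramp_least) (use dyadic_cross(2) in \<open>force simp: not_le\<close>)+
  show "real k / 2^n \<le> ramp a b (dyadic a b n k)"
    using ramp_upper[OF k] dyadic_mem[OF k] by simp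
qed

lemma ramp_below: "x \<preceq> a \<Longrightarrow> ramp a b x = 0"
  using ramp_mono[of x a a b] ramp_dyadic[of 0 0] ab root_le_in ramp_nonneg[of a b x] by fastforce

lemma ramp_above: "\<lbrakk>b \<preceq> x; x \<in> T\<rbrakk> \<Longrightarrow> ramp a b x = 1"
  using ramp_mono[of b x a b] ramp_dyadic[of 1 0] ramp_le_1[of a b x] by simp

text \<open>The witness is a chain point \<open>e\<close> with dyadic value between
  \<open>\<alpha>\<close> and \<open>\<beta>\<close>. It is below \<open>x'\<close> because a chain
  point of larger value is, and above \<open>x\<close> because \<open>e \<preceq> x\<close> would
  contradict monotonicity of the ramp.\<close>

lemma ramp_gap:
  assumes x: "x \<preceq> x'" "x' \<in> T" and lt: "ramp a b x < \<alpha>" "\<alpha> < \<beta>" "\<beta> < ramp a b x'"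
  shows "\<exists>e. x \<preceq> e \<and> e \<preceq> x' \<and> \<alpha> < ramp a b e \<and> ramp a b e < \<beta>"
proof -
  have "0 \<le> \<alpha>" "\<beta> \<le> 1" using lt ramp_nonneg[of a b x] ramp_le_1[of a b x'] by linarith+
  then obtain n k where k: "k \<le> 2^n" "\<alpha> < real k / 2^n" "real k / 2^n < \<beta>"
    using dyadic_density lt(2) by metis
  define e where "e = dyadic a b n k"
  have e: "e \<in> T" "ramp a b e = real k / 2^n" unfolding e_def using k(1) by (rule dyadic_mem, rule ramp_dyadic)
  have "real k / 2^n < ramp a b x'" using k lt by linarith
  then obtain m l where l: "l \<le> 2^m" "dyadic a b m l \<preceq> x'" "real k / 2^n < real l / 2^m"
    using ramp_greater[of "real k / 2^n"] by (metis divide_nonneg_pos of_nat_0_le_iff zero_less_numeral zero_less_power)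
  then have "e \<preceq> x'" unfolding e_def using dyadic_cross(1)[OF l(3,1)] root_le_trans x(2) by blast
  moreover have "x \<preceq> e"
  proof (rule ccontr)
    assume "\<not> x \<preceq> e"
    then have "e \<preceq> x" using root_le_comparable[OF x(1) \<open>e \<preceq> x'\<close> x(2)] by blast
    then have "ramp a b e \<le> ramp a b x" using ramp_mono x(1) root_le_in by blast
    then show False using e(2) k lt by linarith
  qed
  ultimately show ?thesis using e(2) k by auto
qed

end

text \<open>All index pairs are enumerated, with the zero function for pairs that are not strictly
  increasing. A pair \<open>y i\<close>, \<open>y j\<close> strictly increasing between
  \<open>x\<close> and \<open>x'\<close> has ramp 0 at \<open>x\<close> and 1 at
  \<open>x'\<close>.\<close>

lemma separating_family_ramps:
  assumes edges: "tree_edges T c = {}" and y: "\<And>k. y k \<in> T"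
    and dense: "\<And>m x. \<lbrakk>m \<preceq> x; x \<in> T; m \<noteq> x\<rbrakk> \<Longrightarrow> \<exists>k. y k \<preceq> x \<and> m \<preceq> y k \<and> y k \<noteq> m"
  shows "separating_family T c \<rho> (\<lambda>k x. case prod_decode k of (i, j) \<Rightarrow>
      if y i \<preceq> y j \<and> y i \<noteq> y j then ramp (y i) (y j) x else 0)"
    (is "separating_family T c \<rho> ?F")
proof
  fix x x' and k :: nat
  obtain i j where ij: "prod_decode k = (i, j)" by fastforce
  note ramp = ramp_below[OF edges _ y, of "y i" j] ramp_gap[OF edges _ y, of "y i" j]
  show "0 \<le> ?F k x" "?F k x \<le> 1" using ramp_nonneg ramp_le_1 by (simp_all add: ij)
  show "?F k \<rho> = 0" using ramp root_least y by (simp add: ij)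
  assume x: "x \<preceq> x'" "x' \<in> T"
  show "?F k x \<le> ?F k x'" using ramp_mono[OF x] by (simp add: ij)
  fix \<alpha> \<beta> assume "?F k x < \<alpha>" "\<alpha> < \<beta>" "\<beta> < ?F k x'"
  then show "\<exists>e. x \<preceq> e \<and> e \<preceq> x' \<and> \<alpha> < ?F k e \<and> ?F k e < \<beta>"
    using ramp(2)[OF _ _ x, of \<alpha> \<beta>] by (simp add: ij split: if_splits)
next
  fix x x' assume x: "x \<preceq> x'" "x' \<in> T" "x \<noteq> x'"
  then obtain j where j: "y j \<preceq> x'" "x \<preceq> y j" "y j \<noteq> x" using dense by blast
  \<comment> \<open>Density is next applied below an intermediate point, so that \<open>y i\<close>
    differs from \<open>y j\<close>.\<close>
  note m = mid[OF edges j(2) y j(3)[symmetric]]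
  have mT: "mid x (y j) \<in> T" using m root_le_in by blast
  obtain i where i: "y i \<preceq> mid x (y j)" "x \<preceq> y i" "y i \<noteq> x"
    using dense[OF m(1) mT m(3)[symmetric]] by blast
  have "y i \<preceq> y j" using root_le_trans[OF i(1) m(2) y] .
  moreover have "y i \<noteq> y j" using i(1) m(2,4) root_le_antisym by metis
  ultimately have F: "?F (prod_encode (i, j)) x = 0" "?F (prod_encode (i, j)) x' = 1"
    using ramp_below[OF edges _ y _ i(2)] ramp_above[OF edges _ y _ j(1) x(2)] by simp_all
  have "?F (prod_encode (i, j)) x < ?F (prod_encode (i, j)) x'" unfolding F by simp
  then show "\<exists>k. ?F k x < ?F k x'" by (rule exI)
qed

end

section \<open>The characterisation\<close>

lemma (in rooted_tree) separable_tree_height: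
  assumes "order_separable T c"
  shows "\<exists>y h. tree_height T c \<rho> y h"
proof (rule separable_enumeration[OF assms])
  fix y :: "nat \<Rightarrow> 'a"
  assume "\<And>k. y k \<in> T"
    "\<And>m x. \<lbrakk>m \<preceq> x; x \<in> T; m \<noteq> x\<rbrakk> \<Longrightarrow> \<exists>k. y k \<preceq> x \<and> m \<preceq> y k \<and> y k \<noteq> m"
  then show ?thesis using tree_height_atomic by blast
qed

lemma (in rooted_tree) separable_continuum_height:
  assumes cont: "algebraic_continuum_tree T c" and sep: "order_separable T c"
  shows "\<exists>y h. tree_height T c \<rho> y h \<and>
    (\<forall>x t. x \<in> T \<longrightarrow> 0 \<le> t \<longrightarrow> t \<le> h x \<longrightarrow> (\<exists>e. e \<preceq> x \<and> h e = t))"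
proof (rule separable_enumeration[OF sep])
  fix y :: "nat \<Rightarrow> 'a"
  assume y: "\<And>k. y k \<in> T"
    "\<And>m x. \<lbrakk>m \<preceq> x; x \<in> T; m \<noteq> x\<rbrakk> \<Longrightarrow> \<exists>k. y k \<preceq> x \<and> m \<preceq> y k \<and> y k \<noteq> m"
  interpret algebraic_continuum_tree T c by fact
  interpret F: separating_family T c \<rho> "\<lambda>k x. case prod_decode k of (i, j) \<Rightarrow>
      if y i \<preceq> y j \<and> y i \<noteq> y j then ramp (y i) (y j) x else 0"
    by (rule separating_family_ramps[OF no_edges y])
  have "tree_height T c \<rho> y F.weight"
    using y F.weight_bounds F.weight_strict by unfold_locales auto
  then show ?thesis using F.weight_ivt[OF complete] by blast
qed

lemma continuum_tree_metric:
  assumes "algebraic_continuum_tree T c" and sep: "order_separable T c"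
  shows "\<exists>r. metric_tree_map T r c \<and> compact_space (Metric_space.mtopology T r)
    \<and> connected_space (Metric_space.mtopology T r)"
proof -
  interpret algebraic_continuum_tree T c by fact
  obtain \<rho> where "\<rho> \<in> T" using nonempty by blast
  then interpret rooted_tree T c \<rho> by unfold_locales
  obtain y h where "tree_height T c \<rho> y h"
    and ivt: "\<And>x t. \<lbrakk>x \<in> T; 0 \<le> t; t \<le> h x\<rbrakk> \<Longrightarrow> \<exists>e. tree_le T c \<rho> e x \<and> h e = t"
    using separable_continuum_height[OF assms] by blast
  interpret tree_height T c \<rho> y h by fact
  show ?thesis
    by (rule compact_connected_metric[OF complete ivt])
qed

lemma separable_tree_height_exists:
  assumes "algebraic_tree T c" "order_separable T c"
  shows "\<exists>\<rho> y h. tree_height T c \<rho> y h"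
proof -
  interpret algebraic_tree T c by fact
  obtain \<rho> where "\<rho> \<in> T" using nonempty by blast
  then interpret rooted_tree T c \<rho> by unfold_locales
  show ?thesis using separable_tree_height[OF assms(2)] by blast
qed

text \<open>Order separability does not restrict directly, as the countable set in \<open>T'\<close>
  may miss the copy of \<open>T\<close>. A totally bounded metric does restrict, and it gives order
  separability back.\<close>

lemma subtree_of_separable_continuum:
  assumes T': "algebraic_continuum_tree T' c'" "order_separable T' c'" and inj: "inj_on f T"
    and sub: "subtree (f ` T) (transport_map f T c) T' c'" and ne: "T \<noteq> {}"
    and closed: "\<And>x y z. \<lbrakk>x \<in> T; y \<in> T; z \<in> T\<rbrakk> \<Longrightarrow> c x y z \<in> T"
  shows "algebraic_tree T c \<and> order_separable T c"
proof -
  obtain r where r: "metric_tree_map T' r c'" and comp: "compact_space (Metric_space.mtopology T' r)"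
    using continuum_tree_metric[OF T'] by blast
  interpret T': metric_tree_map T' r c' by fact
  have fT: "f ` T \<subseteq> T'" using sub by (simp add: subtree_def)
  have hom: "f (c x y z) = c' (f x) (f y) (f z)" if "x \<in> T" "y \<in> T" "z \<in> T" for x y z
  proof -
    have "transport_map f T c (f x) (f y) (f z) = c' (f x) (f y) (f z)"
      using sub that unfolding subtree_def by blast
    then show ?thesis using that inj by (simp add: transport_map_def inv_into_f_f)
  qed
  interpret T: metric_tree_map T "\<lambda>x y. r (f x) (f y)" c
    by (rule metric_tree_map_pullback[where f = f, OF r inj fT ne closed hom])
  have "T.mtotally_bounded T"
    by (rule mtotally_bounded_pullback[where f = f, OF T'.Metric_space_axioms T.Metric_space_axioms fT
          T'.compact_imp_mtotally_bounded[OF comp]])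
  then show ?thesis using T.algebraic_tree T.order_separable by blast
qed

theorem theorem1:
  fixes T :: "'a set" and c :: "'a \<Rightarrow> 'a \<Rightarrow> 'a \<Rightarrow> 'a"
  assumes "T \<noteq> {}"
    and "\<And>x y z. \<lbrakk>x \<in> T; y \<in> T; z \<in> T\<rbrakk> \<Longrightarrow> c x y z \<in> T"
  shows
    "(algebraic_continuum_tree T c \<and> order_separable T c \<longleftrightarrow>
       (\<exists>r. real_tree T r \<and> compact_space (Metric_space.mtopology T r) \<and> induced_by_metric T c r))
     \<and>
     (algebraic_tree T c \<and> order_separable T c \<longleftrightarrow>
       (\<exists>(T' :: ('a + real) set) c'.
          algebraic_continuum_tree T' c' \<and> order_separable T' c' \<and>
          subtree (Inl ` T) (transport_map Inl T c) T' c'))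
     \<and>
     (\<forall>(T' :: 'b set) c' f.
        algebraic_continuum_tree T' c' \<and> order_separable T' c' \<and> inj_on f T \<and>
        subtree (f ` T) (transport_map f T c) T' c' \<longrightarrow>
        algebraic_tree T c \<and> order_separable T c)
     \<and>
     (algebraic_tree T c \<and> order_separable T c \<longrightarrow>
       (\<exists>r. metric_tree T r \<and> Metric_space.mtotally_bounded T r T \<and> induced_by_metric T c r))"
proof (intro conjI)
  show "algebraic_continuum_tree T c \<and> order_separable T c \<longleftrightarrow>
       (\<exists>r. real_tree T r \<and> compact_space (Metric_space.mtopology T r) \<and> induced_by_metric T c r)"
  proof
    assume "algebraic_continuum_tree T c \<and> order_separable T c"
    then obtain r where r: "metric_tree_map T r c" "compact_space (Metric_space.mtopology T r)"
        "connected_space (Metric_space.mtopology T r)"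
      using continuum_tree_metric by blast
    interpret metric_tree_map T r c by fact
    have "real_tree T r" by unfold_locales (rule r(3))
    then show "\<exists>r. real_tree T r \<and> compact_space (Metric_space.mtopology T r) \<and> induced_by_metric T c r"
      using r metric_tree_map_iff[OF assms(1)] by blast
  next
    assume "\<exists>r. real_tree T r \<and> compact_space (Metric_space.mtopology T r) \<and> induced_by_metric T c r"
    then obtain r where r: "real_tree T r" "compact_space (Metric_space.mtopology T r)" "induced_by_metric T c r"
      by blast
    interpret real_tree T r by fact
    interpret metric_tree_map T r c
      using metric_tree_map_iff[OF assms(1)] metric_tree r(3) by blast
    show "algebraic_continuum_tree T c \<and> order_separable T c"
      using algebraic_continuum_tree[OF connected r(2)] order_separable[OF compact_imp_mtotally_bounded[OF r(2)]]
      by blast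
  qed
next
  show "algebraic_tree T c \<and> order_separable T c \<longleftrightarrow>
       (\<exists>(T' :: ('a + real) set) c'.
          algebraic_continuum_tree T' c' \<and> order_separable T' c' \<and>
          subtree (Inl ` T) (transport_map Inl T c) T' c')"
  proof
    assume "algebraic_tree T c \<and> order_separable T c"
    then obtain \<rho> y h where "tree_height T c \<rho> y h" using separable_tree_height_exists by blast
    then interpret tree_height T c \<rho> y h .
    show "\<exists>(T' :: ('a + real) set) c'.
          algebraic_continuum_tree T' c' \<and> order_separable T' c' \<and>
          subtree (Inl ` T) (transport_map Inl T c) T' c'"
      by (rule sum_extension)
  next
    assume "\<exists>(T' :: ('a + real) set) c'.
          algebraic_continuum_tree T' c' \<and> order_separable T' c' \<and>
          subtree (Inl ` T) (transport_map Inl T c) T' c'"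
    then obtain T' :: "('a + real) set" and c' where "algebraic_continuum_tree T' c'" "order_separable T' c'"
        "subtree (Inl ` T) (transport_map Inl T c) T' c'" by blast
    then show "algebraic_tree T c \<and> order_separable T c"
      using subtree_of_separable_continuum[of T' c' Inl T c] assms by simp
  qed
next
  show "\<forall>(T' :: 'b set) c' f.
        algebraic_continuum_tree T' c' \<and> order_separable T' c' \<and> inj_on f T \<and>
        subtree (f ` T) (transport_map f T c) T' c' \<longrightarrow>
        algebraic_tree T c \<and> order_separable T c"
  proof (intro allI impI, elim conjE)
    fix T' :: "'b set" and c' f
    assume "algebraic_continuum_tree T' c'" "order_separable T' c'" "inj_on f T"
      "subtree (f ` T) (transport_map f T c) T' c'"
    then show "algebraic_tree T c \<and> order_separable T c"
      using assms by (rule subtree_of_separable_continuum)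
  qed
next
  show "algebraic_tree T c \<and> order_separable T c \<longrightarrow>
       (\<exists>r. metric_tree T r \<and> Metric_space.mtotally_bounded T r T \<and> induced_by_metric T c r)"
  proof
    assume "algebraic_tree T c \<and> order_separable T c"
    then obtain \<rho> y h where "tree_height T c \<rho> y h" using separable_tree_height_exists by blast
    then interpret tree_height T c \<rho> y h .
    show "\<exists>r. metric_tree T r \<and> Metric_space.mtotally_bounded T r T \<and> induced_by_metric T c r"
      using totally_bounded_metric metric_tree_map_iff[OF assms(1)] by blast
  qed
qed

end
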